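(* Let $\mathcal T$ be the Teichmüller space of (possibly weighted) punctured Riemann surfaces of genus $p$ with $n$ labeled punctures of fixed weights $a_1,\dots,a_n\in[1/2,1]$ (with $n=0$ allowed), each surface being equipped with its hyperbolic (conical) metric. Let $s_0\in\mathcal T$ correspond to a surface $X$, let $(\tau^i,\ell^i)_i$ be Fenchel–Nielsen coordinates, and let $\gamma_i$ be the closed geodesic on $X$ corresponding to the index $i$. Then the tangent vector $\partial/\partial\tau^i|_{s_0}$ applied to a holomorphic quadratic differential $\varphi=\varphi(z)dz^2$ is given by the integration of the quadratic differential along the corresponding closed geodesic: $$\left(\left.\frac{\partial}{\partial\tau^i}\right|_{s_0},\ \varphi(z)dz^2\right)=\frac{\sqrt{-1}}{2}\int_{\gamma_i}\varphi .$$
   Context: Surfaces and metrics. A weighted punctured Riemann surface is a pair $(X,\mathbf a)$, with $X$ a compact Riemann surface of genus $p$ and $\mathbf a=\sum_{j=1}^n a_jp_j$ an $\mathbb R$-divisor with distinct labeled points $p_j$ and $0<a_j\le1$, such that $K_X+\mathbf a$ has positive degree. Here $a_j\in[1/2,1]$, i.e. cone angles do not exceed $\pi$; under this assumption Fenchel–Nielsen coordinates exist and pants decompositions avoid the punctures. Such a surface carries a unique hyperbolic conical metric $g=g(z)|dz|^2$: in local holomorphic coordinates $z$ centered at $p_j$ it has the form $\frac{\rho(z)}{|z|^{2a_j}}|dz|^2$ if $a_j<1$, and $\frac{\rho(z)}{|z|^2\log^2(|z|^2)}|dz|^2$ if $a_j=1$, with $\rho$ continuous and positive. The metric is normalized by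 $\partial^2\log g/\partial z\,\partial\bar z=g$; lengths are taken with respect to $\|\dot u\|^2=g(u)|\dot u|^2$. For $n=0$ this is the hyperbolic metric on a compact Riemann surface. Teichmüller space and pairing. With the weights fixed, $\mathcal T$ is identified as a complex manifold with the Teichmüller space $\mathcal T_{p,n}$. Its cotangent space at $s_0$ is the space of holomorphic quadratic differentials $H^0(X,\mathcal O_X(2K_X+D))$, $D=\sum_jp_j$ (at most simple poles at the punctures). A tangent vector is represented by a Beltrami differential $\mu=\mu(z)\frac{\partial}{\partial z}\overline{dz}$ (not necessarily harmonic), and the pairing of tangent and cotangent vectors is $$(\mu,\varphi(z)dz^2)=\int_X\mu(z)\varphi(z)\,dA,$$ where $dA=\frac{\sqrt{-1}}2dz\wedge\overline{dz}$ is the Euclidean area element. For a real tangent vector, the pairing with $\varphi$ is by definition that of its $(1,0)$-part. If a family with parameter $\tau$ is described by a differentiable trivialization $\zeta(z,\tau)$ equal to the identity at $\tau=0$, the image of the $(1,0)$-component of $\partial/\partial\tau$ under the Kodaira–Spencer map is represented by the Beltrami differential $\frac{\partial^2\zeta}{\partial\tau\,\partial\bar z}\big|_{\tau=0}\frac{\partial}{\partial z}\overline{dz}$. Fenchel–Nielsen coordinates and twists. Given a pants decomposition of the (punctured) surface by closed geodesics $\gamma_i$, the coordinates consist of the lengths $\ell^i$ of the $\gamma_i$ and the twist parameters $\tau^i$ along $\gamma_i$, measured as hyperbolic length. The vector $\partial/\partial\tau^i|_{s_0}$ is the tangent vector of the twist along $\gamma=\gamma_i$, described as follows. Let $\gamma$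 have length $\ell_0=2\pi r_0$. Embed an annulus $W=\{r_1<|z|<r_2\}$ in $X$ so that $\gamma$ corresponds to the circle $|z|=r_0$, $r_1<r_0<r_2$, with unit speed parameterization $u(t)=r_0e^{\sqrt{-1}\,t/r_0}$, $0\le t\le\ell_0$. The twist by $\tau\in\mathbb R$ is the deformation of $X$ given by the holomorphic automorphisms $z\mapsto e^{\sqrt{-1}\,\tau/r_0}z$ of $W$, viewed as a cocycle of vertical automorphisms for an open covering of $X$ with two elements; a differentiable trivialization, equal to the identity on the complement of $W$, is $$\zeta(z,\tau)=e^{\sqrt{-1}\,\frac{\tau}{r_0}h(r)}z,\qquad r=|z|,$$ where $h\in C^\infty((r_1,r_2),\mathbb R)$ is identically $0$ near $r_1$ and identically $1$ near $r_2$. The value $\tau=\ell_0$ represents a Dehn twist. Integral along a geodesic. If $\gamma$ is a closed geodesic of length $\ell$ with unit speed parameterization $u(t)$, $0\le t\le\ell$, then $\int_\gamma\varphi:=\int_0^\ell\varphi(u(t))\,\dot u(t)^2\,dt$.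
   Formalization: With the printed trivialization ζ and Kodaira–Spencer formula the pairing equals −(√−1/2)∫φ; the formal statement reverses the direction of the twist, applying the formula to the inverse of ζ(·,τ), so that the stated sign holds. *)

theory Defs
  imports "HOL-Complex_Analysis.Complex_Analysis" "HOL-Homology.Homology"
begin

text \<open>Compact Riemann surfaces. A chart is a domain together with a coordinate map, and a surface
  is a topology with an atlas. All geometric objects are families of coordinate expressions indexed
  by the charts of the maximal atlas; values outside the coordinate image are irrelevant.\<close>

type_synonym 'a chart = "'a set \<times> ('a \<Rightarrow> complex)"

definition coord_image :: "'a chart \<Rightarrow> complex set" where
  "coord_image c = snd c ` fst c"

definition is_chart :: "'a topology \<Rightarrow> 'a chart \<Rightarrow> bool" where
  "is_chart X c \<longleftrightarrow> openin X (fst c) \<and> open (coord_image c) \<and>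
     homeomorphic_map (subtopology X (fst c)) (top_of_set (coord_image c)) (snd c)"

definition transition :: "'a chart \<Rightarrow> 'a chart \<Rightarrow> complex \<Rightarrow> complex" where
  "transition c d z = snd d (the_inv_into (fst c) (snd c) z)"

definition overlap :: "'a chart \<Rightarrow> 'a chart \<Rightarrow> complex set" where
  "overlap c d = snd c ` (fst c \<inter> fst d)"

definition hol_compatible :: "'a chart \<Rightarrow> 'a chart \<Rightarrow> bool" where
  "hol_compatible c d \<longleftrightarrow>
     transition c d holomorphic_on overlap c d \<and> transition d c holomorphic_on overlap d c"

definition compact_riemann_surface :: "'a topology \<Rightarrow> 'a chart set \<Rightarrow> bool" where
  "compact_riemann_surface X \<A> \<longleftrightarrow>
     topspace X \<noteq> {} \<and> compact_space X \<and> connected_space X \<and> Hausdorff_space X \<and>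
     (\<forall>c\<in>\<A>. is_chart X c) \<and> (\<Union>c\<in>\<A>. fst c) = topspace X \<and>
     (\<forall>c\<in>\<A>. \<forall>d\<in>\<A>. hol_compatible c d)"

definition hol_charts :: "'a topology \<Rightarrow> 'a chart set \<Rightarrow> 'a chart set" where
  "hol_charts X \<A> = {c. is_chart X c \<and> (\<forall>d\<in>\<A>. hol_compatible c d)}"

definition has_genus :: "'a topology \<Rightarrow> nat \<Rightarrow> bool" where
  "has_genus X p \<longleftrightarrow> homology_group 1 X \<cong> free_Abelian_group {..<2 * p}"

text \<open>The last condition says that $K_X + \mathbf{a}$ has positive degree.\<close>

definition weighted_punctured_surface ::
  "'a topology \<Rightarrow> 'a chart set \<Rightarrow> nat \<Rightarrow> nat \<Rightarrow> (nat \<Rightarrow> 'a) \<Rightarrow> (nat \<Rightarrow> real) \<Rightarrow> bool" where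
  "weighted_punctured_surface X \<A> p n pt a \<longleftrightarrow>
     compact_riemann_surface X \<A> \<and> has_genus X p \<and>
     pt ` {1..n} \<subseteq> topspace X \<and> inj_on pt {1..n} \<and>
     (\<forall>j\<in>{1..n}. 0 < a j \<and> a j \<le> 1) \<and>
     2 * real p - 2 + (\<Sum>j=1..n. a j) > 0"

definition wirtinger :: "(complex \<Rightarrow> complex) \<Rightarrow> complex \<Rightarrow> complex" where
  "wirtinger f z =
     (frechet_derivative f (at z) 1 - \<i> * frechet_derivative f (at z) \<i>) / 2"

definition wirtinger_bar :: "(complex \<Rightarrow> complex) \<Rightarrow> complex \<Rightarrow> complex" where
  "wirtinger_bar f z =
     (frechet_derivative f (at z) 1 + \<i> * frechet_derivative f (at z) \<i>) / 2"

primrec C_k_on :: "nat \<Rightarrow> complex set \<Rightarrow> (complex \<Rightarrow> real) \<Rightarrow> bool" where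
  "C_k_on 0 S f \<longleftrightarrow> continuous_on S f"
| "C_k_on (Suc k) S f \<longleftrightarrow> (\<forall>z\<in>S. f differentiable (at z)) \<and>
     C_k_on k S (\<lambda>z. frechet_derivative f (at z) 1) \<and>
     C_k_on k S (\<lambda>z. frechet_derivative f (at z) \<i>)"

text \<open>The metric is $g(z)\,|dz|^2$ with $\partial^2 \log g / \partial z \partial\bar z = g$ away from
  the punctures; \<^term>\<open>g c\<close> is the coefficient in the chart \<^term>\<open>c\<close>.\<close>

definition punctured_image :: "'a set \<Rightarrow> 'a chart \<Rightarrow> complex set" where
  "punctured_image P c = snd c ` (fst c - P)"

definition cone_singularity :: "real \<Rightarrow> (complex \<Rightarrow> real) \<Rightarrow> bool" where
  "cone_singularity \<alpha> f \<longleftrightarrow>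
     (\<exists>e>0. \<exists>\<rho>. continuous_on (ball 0 e) \<rho> \<and> (\<forall>z\<in>ball 0 e. \<rho> z > 0) \<and>
        (\<forall>z\<in>ball 0 e - {0}. f z =
           (if \<alpha> < 1 then \<rho> z / cmod z powr (2 * \<alpha>)
            else \<rho> z / ((cmod z)\<^sup>2 * (ln ((cmod z)\<^sup>2))\<^sup>2))))"

definition hyperbolic_conical_metric ::
  "'a topology \<Rightarrow> 'a chart set \<Rightarrow> nat \<Rightarrow> (nat \<Rightarrow> 'a) \<Rightarrow> (nat \<Rightarrow> real) \<Rightarrow>
   ('a chart \<Rightarrow> complex \<Rightarrow> real) \<Rightarrow> bool" where
  "hyperbolic_conical_metric X \<A> n pt a g \<longleftrightarrow>
     (\<forall>c\<in>hol_charts X \<A>.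
        (\<forall>z\<in>punctured_image (pt ` {1..n}) c. g c z > 0) \<and>
        (\<forall>k. C_k_on k (punctured_image (pt ` {1..n}) c) (g c)) \<and>
        (\<forall>z\<in>punctured_image (pt ` {1..n}) c.
           wirtinger (wirtinger_bar (\<lambda>w. of_real (ln (g c w)))) z = of_real (g c z)) \<and>
        (\<forall>d\<in>hol_charts X \<A>. \<forall>z\<in>overlap c d \<inter> punctured_image (pt ` {1..n}) c.
           g c z = g d (transition c d z) * (cmod (deriv (transition c d) z))\<^sup>2) \<and>
        (\<forall>j\<in>{1..n}. pt j \<in> fst c \<and> snd c (pt j) = 0 \<longrightarrow> cone_singularity (a j) (g c)))"

text \<open>$H^0(X, \mathcal{O}_X(2K_X + D))$ with $D$ the reduced divisor supported on \<^term>\<open>P\<close>.\<close>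

definition quadratic_differentials ::
  "'a topology \<Rightarrow> 'a chart set \<Rightarrow> 'a set \<Rightarrow> ('a chart \<Rightarrow> complex \<Rightarrow> complex) set" where
  "quadratic_differentials X \<A> P = {\<phi>. \<forall>c\<in>hol_charts X \<A>.
     \<phi> c holomorphic_on punctured_image P c \<and>
     (\<forall>d\<in>hol_charts X \<A>. \<forall>z\<in>overlap c d \<inter> punctured_image P c.
        \<phi> c z = \<phi> d (transition c d z) * (deriv (transition c d) z)\<^sup>2) \<and>
     (\<forall>q\<in>P \<inter> fst c. \<exists>e>0. \<exists>F. F holomorphic_on ball (snd c q) e \<and>
        (\<forall>z\<in>ball (snd c q) e - {snd c q}. (z - snd c q) * \<phi> c z = F z))}"

text \<open>Beltrami differentials $\mu(z)\,\frac{\partial}{\partial z}\overline{dz}$, bounded and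
  measurable.\<close>

definition beltrami_differentials ::
  "'a topology \<Rightarrow> 'a chart set \<Rightarrow> 'a set \<Rightarrow> ('a chart \<Rightarrow> complex \<Rightarrow> complex) set" where
  "beltrami_differentials X \<A> P = {\<mu>.
     (\<exists>K. \<forall>c\<in>hol_charts X \<A>. \<forall>z\<in>punctured_image P c. cmod (\<mu> c z) \<le> K) \<and>
     (\<forall>c\<in>hol_charts X \<A>. set_borel_measurable borel (punctured_image P c) (\<mu> c) \<and>
        (\<forall>d\<in>hol_charts X \<A>. \<forall>z\<in>overlap c d \<inter> punctured_image P c.
           \<mu> c z = \<mu> d (transition c d z) *
             cnj (deriv (transition c d) z) / deriv (transition c d) z))}"

text \<open>Integral over the surface of a $(1,1)$-form given in each chart as $\omega(z)\,dA$: cut the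
  surface into finitely many measurable pieces, each contained in a chart domain. For forms
  obeying the transformation law $\omega_c = (\omega_d \circ f)\,|f'|^2$ (off a finite set) the
  value does not depend on the decomposition.\<close>

definition has_surface_integral ::
  "'a topology \<Rightarrow> 'a chart set \<Rightarrow> ('a chart \<Rightarrow> complex \<Rightarrow> complex) \<Rightarrow> complex \<Rightarrow> bool" where
  "has_surface_integral X \<A> \<omega> I \<longleftrightarrow>
     (\<exists>m::nat. \<exists>c E. (\<forall>k<m. c k \<in> hol_charts X \<A> \<and> E k \<subseteq> fst (c k) \<and>
            snd (c k) ` E k \<in> sets borel \<and> set_integrable lborel (snd (c k) ` E k) (\<omega> (c k))) \<and>
        disjoint_family_on E {..<m} \<and> (\<Union>k<m. E k) = topspace X \<and>
        I = (\<Sum>k<m. LINT z:snd (c k) ` E k|lborel. \<omega> (c k) z))"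

definition surface_integral ::
  "'a topology \<Rightarrow> 'a chart set \<Rightarrow> ('a chart \<Rightarrow> complex \<Rightarrow> complex) \<Rightarrow> complex" where
  "surface_integral X \<A> \<omega> = (THE I. has_surface_integral X \<A> \<omega> I)"

definition beltrami_pairing ::
  "'a topology \<Rightarrow> 'a chart set \<Rightarrow> ('a chart \<Rightarrow> complex \<Rightarrow> complex) \<Rightarrow>
   ('a chart \<Rightarrow> complex \<Rightarrow> complex) \<Rightarrow> complex" where
  "beltrami_pairing X \<A> \<mu> \<phi> = surface_integral X \<A> (\<lambda>c z. \<mu> c z * \<phi> c z)"

text \<open>A (1,0) tangent vector of the Teichmueller space at the point given by the surface is a class
  of Beltrami differentials modulo those that annihilate all quadratic differentials, and the
  cotangent space is \<^const>\<open>quadratic_differentials\<close>.\<close>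

definition tangent_vector ::
  "'a topology \<Rightarrow> 'a chart set \<Rightarrow> 'a set \<Rightarrow> ('a chart \<Rightarrow> complex \<Rightarrow> complex) \<Rightarrow>
   ('a chart \<Rightarrow> complex \<Rightarrow> complex) set" where
  "tangent_vector X \<A> P \<mu> = {\<nu> \<in> beltrami_differentials X \<A> P.
     \<forall>\<phi>\<in>quadratic_differentials X \<A> P. beltrami_pairing X \<A> \<nu> \<phi> = beltrami_pairing X \<A> \<mu> \<phi>}"

definition tangent_pairing ::
  "'a topology \<Rightarrow> 'a chart set \<Rightarrow> ('a chart \<Rightarrow> complex \<Rightarrow> complex) set \<Rightarrow>
   ('a chart \<Rightarrow> complex \<Rightarrow> complex) \<Rightarrow> complex" where
  "tangent_pairing X \<A> v \<phi> = (THE w. v \<noteq> {} \<and> (\<forall>\<nu>\<in>v. beltrami_pairing X \<A> \<nu> \<phi> = w))"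

text \<open>Simple closed geodesics with unit speed parametrization \<^term>\<open>u\<close> and length \<^term>\<open>L\<close>, extended
  periodically. In a chart the geodesic equation of the conformal metric $g\,|dz|^2$ is
  $\ddot u + \frac{\partial \log g}{\partial z}(u)\,\dot u^2 = 0$.\<close>

definition simple_closed_geodesic ::
  "'a topology \<Rightarrow> 'a chart set \<Rightarrow> 'a set \<Rightarrow> ('a chart \<Rightarrow> complex \<Rightarrow> real) \<Rightarrow>
   (real \<Rightarrow> 'a) \<Rightarrow> real \<Rightarrow> bool" where
  "simple_closed_geodesic X \<A> P g u L \<longleftrightarrow>
     0 < L \<and> range u \<subseteq> topspace X - P \<and> continuous_map euclideanreal X u \<and>
     (\<forall>t. u (t + L) = u t) \<and> inj_on u {0..<L} \<and>
     (\<forall>c\<in>hol_charts X \<A>. \<forall>t. u t \<in> fst c \<longrightarrow>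
        (\<exists>v'. (\<forall>\<^sub>F s in nhds t. ((\<lambda>s. snd c (u s)) has_vector_derivative v' s) (at s)) \<and>
           (v' has_vector_derivative
              - wirtinger (\<lambda>w. of_real (ln (g c w))) (snd c (u t)) * (v' t)\<^sup>2) (at t) \<and>
           g c (snd c (u t)) * (cmod (v' t))\<^sup>2 = 1))"

text \<open>The complement of the curves and the punctures consists of topological pairs of pants, that
  is, spheres with three points removed; a puncture occupies one end of such a piece.\<close>

definition geodesic_pants_decomposition ::
  "'a topology \<Rightarrow> 'a chart set \<Rightarrow> 'a set \<Rightarrow> ('a chart \<Rightarrow> complex \<Rightarrow> real) \<Rightarrow>
   nat \<Rightarrow> (nat \<Rightarrow> real \<Rightarrow> 'a) \<Rightarrow> (nat \<Rightarrow> real) \<Rightarrow> bool" where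
  "geodesic_pants_decomposition X \<A> P g N \<gamma> L \<longleftrightarrow>
     (\<forall>i\<in>{1..N}. simple_closed_geodesic X \<A> P g (\<gamma> i) (L i)) \<and>
     disjoint_family_on (\<lambda>i. range (\<gamma> i)) {1..N} \<and>
     (\<forall>C\<in>connected_components_of
            (subtopology X (topspace X - P - (\<Union>i\<in>{1..N}. range (\<gamma> i)))).
        subtopology X C homeomorphic_space top_of_set (UNIV - {0, 1 :: complex}))"

text \<open>$\int_0^\ell \varphi(u(t))\,\dot u(t)^2\,dt$. The integrand is independent of the chart around
  \<^term>\<open>u t\<close> used to compute it.\<close>

definition geodesic_integral ::
  "'a topology \<Rightarrow> 'a chart set \<Rightarrow> ('a chart \<Rightarrow> complex \<Rightarrow> complex) \<Rightarrow>
   (real \<Rightarrow> 'a) \<Rightarrow> real \<Rightarrow> complex" where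
  "geodesic_integral X \<A> \<phi> u L = integral {0..L} (\<lambda>t.
     let c = SOME c. c \<in> hol_charts X \<A> \<and> u t \<in> fst c
     in \<phi> c (snd c (u t)) * (vector_derivative (\<lambda>s. snd c (u s)) (at t))\<^sup>2)"

definition annulus :: "real \<Rightarrow> real \<Rightarrow> complex set" where
  "annulus r1 r2 = {z. r1 < cmod z \<and> cmod z < r2}"

definition twist_annulus ::
  "'a topology \<Rightarrow> 'a chart set \<Rightarrow> 'a set \<Rightarrow> (real \<Rightarrow> 'a) \<Rightarrow> real \<Rightarrow>
   real \<Rightarrow> real \<Rightarrow> real \<Rightarrow> 'a chart \<Rightarrow> bool" where
  "twist_annulus X \<A> P u L r1 r0 r2 W \<longleftrightarrow>
     0 < r1 \<and> r1 < r0 \<and> r0 < r2 \<and> L = 2 * pi * r0 \<and>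
     W \<in> hol_charts X \<A> \<and> fst W \<inter> P = {} \<and> coord_image W = annulus r1 r2 \<and>
     (\<forall>t. u t \<in> fst W \<and> snd W (u t) = of_real r0 * exp (\<i> * of_real (t / r0)))"

definition twist_cutoff :: "real \<Rightarrow> real \<Rightarrow> (real \<Rightarrow> real) \<Rightarrow> bool" where
  "twist_cutoff r1 r2 h \<longleftrightarrow>
     (\<forall>k. \<forall>r\<in>{r1<..<r2}. ((deriv ^^ k) h) differentiable (at r)) \<and>
     (\<exists>e>0. (\<forall>r\<in>{r1<..<r1 + e}. h r = 0) \<and> (\<forall>r\<in>{r2 - e<..<r2}. h r = 1))"

text \<open>Orientation of the twist. The twisted surface $X_\tau$ is cut along the curve and re-glued: a
  point with coordinate $z$ on the inner side of \<^term>\<open>W\<close> is identified with the point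
  $e^{\sqrt{-1}\,\tau/r_0} z$ of the outer side. In the coordinate of the inner side,
  $\zeta(z,\tau) = e^{\sqrt{-1}\,(\tau/r_0)\,h(|z|)}\,z$ is then a differentiable trivialization
  $X_\tau \to X$ which is the identity off \<^term>\<open>W\<close>. The Kodaira-Spencer formula
  $\mu = \partial^2 Z/\partial\tau\,\partial\bar z|_{\tau = 0}$ applies to the maps $X \to X_\tau$,
  so here it is used with $Z(\cdot,\tau) = \zeta(\cdot,\tau)^{-1}$. (Gluing in the opposite
  direction, so that $Z = \zeta$, reverses the sign of the twist vector.)\<close>

definition twist_trivialization ::
  "(real \<Rightarrow> real) \<Rightarrow> real \<Rightarrow> complex \<Rightarrow> real \<Rightarrow> complex" where
  "twist_trivialization h r0 z \<tau> = exp (\<i> * of_real (\<tau> / r0 * h (cmod z))) * z"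

definition twist_family ::
  "(real \<Rightarrow> real) \<Rightarrow> real \<Rightarrow> real \<Rightarrow> real \<Rightarrow> complex \<Rightarrow> real \<Rightarrow> complex" where
  "twist_family h r1 r0 r2 z \<tau> =
     inv_into (annulus r1 r2) (\<lambda>w. twist_trivialization h r0 w \<tau>) z"

definition kodaira_spencer :: "(complex \<Rightarrow> real \<Rightarrow> complex) \<Rightarrow> complex \<Rightarrow> complex" where
  "kodaira_spencer Z = wirtinger_bar (\<lambda>z. vector_derivative (\<lambda>\<tau>. Z z \<tau>) (at 0))"

definition twist_beltrami ::
  "'a chart \<Rightarrow> (real \<Rightarrow> real) \<Rightarrow> real \<Rightarrow> real \<Rightarrow> real \<Rightarrow> 'a chart \<Rightarrow> complex \<Rightarrow> complex" where
  "twist_beltrami W h r1 r0 r2 c z =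
     (if z \<in> overlap c W
      then kodaira_spencer (twist_family h r1 r0 r2) (transition c W z) *
           cnj (deriv (transition c W) z) / deriv (transition c W) z
      else 0)"

text \<open>The (1,0)-part of $\partial/\partial\tau^i$ at the point given by the surface, computed from an
  annulus \<^term>\<open>W\<close> around $\gamma_i$ and a cut-off function \<^term>\<open>h\<close>.\<close>

definition twist_vector ::
  "'a topology \<Rightarrow> 'a chart set \<Rightarrow> 'a set \<Rightarrow> 'a chart \<Rightarrow> (real \<Rightarrow> real) \<Rightarrow>
   real \<Rightarrow> real \<Rightarrow> real \<Rightarrow> ('a chart \<Rightarrow> complex \<Rightarrow> complex) set" where
  "twist_vector X \<A> P W h r1 r0 r2 = tangent_vector X \<A> P (twist_beltrami W h r1 r0 r2)"

end

theory Submission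
  imports Defs
begin

text \<open>The twist is represented by the Beltrami differential
  $\mu = -\frac{\sqrt{-1}}{2 r_0}\, h'(r)\, \frac{z^2}{r}$, which is supported in the annulus, so the
  pairing with $\varphi$ is an integral over the annulus alone. In polar coordinates it splits into
  $\int h'(r)\,dr = 1$ and the circle integral $\int_0^{2\pi} z^2 \varphi(z)\, d\theta$, which by
  Cauchy's theorem does not depend on $r$. At $r = r_0$ the circle is the geodesic, and
  $\dot u^2 = -u^2/r_0^2$ turns the circle integral into $\int_\gamma \varphi$ up to a constant.\<close>

section \<open>Change of variables and Lebesgue measure on the complex plane\<close>

unbundle no fps_syntax

text \<open>The obstacle is the surface integral: a \<open>THE\<close> over all finite
  decompositions into chart pieces, so a value is available only once every admissible decomposition
  is known to give it. For a form supported in a single chart, uniqueness reduces to a change of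
  variables under transition maps, where the Jacobian |f'|^2 of a holomorphic f matches the
  transformation law of a (1,1)-form. The minus sign of mu is that of the inverse trivialization.
  One factor z of mu comes from the rotation field z d/dz, the other from z/(2r), the derivative of
  r = |z| with respect to the conjugate of z. The 1/r cancels against the area element r dr dtheta,
  and z^2 phi dtheta = -i z phi dz on a circle, which is the form to which Cauchy's theorem applies.
  With J the circle integral, the pairing is -i/(2 r0) J. On the other side dt = r0 dtheta turns
  -1/r0^2 into -1/r0, so the geodesic integral is -J/r0; the two differ by the factor i/2.\<close>

lemma lborel_eq_distr_vec2:
  "(lborel :: complex measure) = distr lborel borel (\<lambda>x::real^2. Complex (x$1) (x$2))"
proof (rule lborel_eqI)
  have mea: "(\<lambda>x::real^2. Complex (x$1) (x$2)) \<in> borel_measurable lborel"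
    unfolding measurable_lborel2 by (intro borel_measurable_continuous_onI) (auto intro!: continuous_intros simp: complex_eq)
  show "emeasure (distr lborel borel (\<lambda>x::real^2. Complex (x$1) (x$2))) (box l u) =
      (\<Prod>b\<in>Basis. (u - l) \<bullet> b)" if le: "\<And>b. b \<in> Basis \<Longrightarrow> l \<bullet> b \<le> u \<bullet> b" for l u :: complex
  proof -
    let ?l = "vector [Re l, Im l] :: real^2" and ?u = "vector [Re u, Im u] :: real^2"
    have *: "(\<lambda>x::real^2. Complex (x$1) (x$2)) -` box l u = box ?l ?u"
      by (auto simp: mem_box_cart forall_2) (auto simp: box_def Basis_complex_def)
    have ll: "Re l \<le> Re u" "Im l \<le> Im u"
      using le[of 1] le[of \<i>] by (auto simp: Basis_complex_def)
    have "emeasure lborel (box ?l ?u) = emeasure lborel (cbox ?l ?u)"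
      by (simp add: emeasure_lborel_box_eq emeasure_lborel_cbox_eq)
    also have "\<dots> = ennreal (measure lborel (cbox ?l ?u))"
      by (intro emeasure_eq_ennreal_measure) (simp add: emeasure_lborel_cbox_eq)
    also have "measure lborel (cbox ?l ?u) = (Re u - Re l) * (Im u - Im l)"
      using ll by (subst content_cbox_cart) (auto simp: UNIV_2 interval_ne_empty_cart forall_2)
    finally show ?thesis
      by (subst emeasure_distr[OF mea]) (auto simp: * Basis_complex_def mult.commute)
  qed
qed simp

text \<open>The plane is modelled twice, each time by the uniqueness of the measure that gives boxes
  their volume: as \<open>real^2\<close> for the Jacobian formula, and here as a product for
  Fubini.\<close>

lemma lborel_eq_distr_pair:
  "(lborel :: complex measure) = distr (lborel \<Otimes>\<^sub>M lborel) borel (\<lambda>(x,y). Complex x y)"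
  unfolding lborel_prod
proof (rule lborel_eqI)
  have mea: "(\<lambda>(x,y). Complex x y) \<in> borel_measurable lborel"
    unfolding measurable_lborel2 by (intro borel_measurable_continuous_onI) (auto intro!: continuous_intros simp: complex_eq case_prod_unfold)
  show "emeasure (distr lborel borel (\<lambda>(x,y). Complex x y)) (box l u) =
      (\<Prod>b\<in>Basis. (u - l) \<bullet> b)" if le: "\<And>b. b \<in> Basis \<Longrightarrow> l \<bullet> b \<le> u \<bullet> b" for l u :: complex
  proof -
    have *: "(\<lambda>(x,y). Complex x y) -` box l u = box (Re l) (Re u) \<times> box (Im l) (Im u)"
      by (auto simp: box_def Basis_complex_def)
    have ll: "Re l \<le> Re u" "Im l \<le> Im u"
      using le[of 1] le[of \<i>] by (auto simp: Basis_complex_def)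
    have "emeasure lborel (box (Re l) (Re u) \<times> box (Im l) (Im u)) = 
         ennreal (Re u - Re l) * ennreal (Im u - Im l)"
      using ll by (subst lborel_prod[symmetric], subst lborel.emeasure_pair_measure_Times) auto
    then show ?thesis
      using ll by (subst emeasure_distr[OF mea]) (auto simp: * Basis_complex_def mult.commute ennreal_mult)
  qed
qed simp

text \<open>By the Cauchy-Riemann equations the real Jacobian determinant of a holomorphic map is
  |f'|^2. The real change of variables on \<open>real^2\<close> is carried to the complex plane
  along the mutually inverse linear maps \<open>q\<close> and \<open>v\<close>; it speaks of
  Lebesgue measure, and Borel measurability of the integrands brings the result back to
  \<open>lborel\<close>.\<close>

lemma holomorphic_change_of_variables:
  fixes f \<omega> :: "complex \<Rightarrow> complex"
  assumes U: "open U" "f holomorphic_on U"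
    and S: "S \<in> sets borel" "S \<subseteq> U" "inj_on f S" and T: "f ` S \<in> sets borel"
    and int: "set_integrable lborel (f ` S) \<omega>"
  shows "set_integrable lborel S (\<lambda>z. (cmod (deriv f z))\<^sup>2 *\<^sub>R \<omega> (f z))" (is ?A)
    and "(LINT z:S|lborel. (cmod (deriv f z))\<^sup>2 *\<^sub>R \<omega> (f z)) = (LINT z:f ` S|lborel. \<omega> z)" (is ?B)
proof -
  define q where "q = (\<lambda>x::real^2. Complex (x$1) (x$2))"
  define v where "v = (\<lambda>z. vector [Re z, Im z] :: real^2)"
  have qv [simp]: "q (v z) = z" and vq [simp]: "v (q x) = x" for z x
    by (auto simp: q_def v_def vec_eq_iff forall_2)
  have blq: "bounded_linear q"
    unfolding q_def by (auto simp: linear_iff complex_eq_iff intro!: linear_conv_bounded_linear[THEN iffD1])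
  have blv: "bounded_linear v"
    unfolding v_def by (auto simp: linear_iff vec_eq_iff forall_2 intro!: linear_conv_bounded_linear[THEN iffD1])
  have meq [measurable]: "q \<in> borel_measurable borel" 
    by (intro borel_measurable_continuous_onI linear_continuous_on blq)
  have lb: "(lborel :: complex measure) = distr lborel borel q"
    unfolding q_def by (rule lborel_eq_distr_vec2)
  have tr: "integrable lborel G \<longleftrightarrow> integrable lborel (\<lambda>x. G (q x))"
      "integral\<^sup>L lborel G = integral\<^sup>L lborel (\<lambda>x. G (q x))"
    if "G \<in> borel_measurable borel" for G :: "complex \<Rightarrow> complex"
    using that by (subst lb, subst integrable_distr_eq integral_distr; simp)+
  define S' where "S' = q -` S"
  define T' where "T' = q -` (f ` S)"
  define g where "g = (\<lambda>x. v (f (q x)))"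
  define g' where "g' = (\<lambda>x h. v (deriv f (q x) * q h))"
  have gS: "g ` S' = T'"
    unfolding g_def S'_def T'_def by (auto simp: image_iff) (metis qv vq vimageI2)
  have qm: "q -` A \<in> sets borel" if "A \<in> sets borel" for A
    using measurable_sets[OF meq that] by simp
  have S'b: "S' \<in> sets borel" and T'b: "T' \<in> sets borel"
    unfolding S'_def T'_def using S T by (auto intro: qm)
  have der: "(g has_derivative g' x) (at x within S')" if "x \<in> S'" for x
  proof -
    have "(f has_derivative (*) (deriv f (q x))) (at (q x))"
      using that S U unfolding S'_def
      by (auto intro!: has_field_derivative_imp_has_derivative holomorphic_derivI)
    then have "((\<lambda>x. f (q x)) has_derivative (\<lambda>h. deriv f (q x) * q h)) (at x)"
      using diff_chain_at[OF bounded_linear_imp_has_derivative[OF blq]] by (fastforce simp: o_def)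
    then have "(g has_derivative g' x) (at x)"
      unfolding g_def g'_def by (rule bounded_linear.has_derivative[OF blv])
    then show ?thesis by (rule has_derivative_at_withinI)
  qed
  have inj: "inj_on g S'"
    using S(3) unfolding g_def S'_def inj_on_def by (metis qv vq vimageE)
  \<comment> \<open>Multiplication by a + ib has the matrix with rows (a, -b) and (b, a), of
    determinant a^2 + b^2.\<close>
  have det: "\<bar>det (matrix (g' x))\<bar> = (cmod (deriv f (q x)))\<^sup>2" for x
    unfolding det_2 cmod_power2
    by (simp add: g'_def matrix_def q_def v_def axis_def power2_eq_square)
  have \<omega>m: "(\<lambda>z. indicator (f ` S) z *\<^sub>R \<omega> z) \<in> borel_measurable borel" 
    using int unfolding set_integrable_def by auto
  have i1: "set_integrable lebesgue T' (\<lambda>x. v (\<omega> (q x)))"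
  proof -
    have "integrable lborel (\<lambda>x. indicator (f ` S) (q x) *\<^sub>R \<omega> (q x))"
      using int \<omega>m by (simp add: set_integrable_def tr)
    then have "integrable lborel (\<lambda>x. v (indicator (f ` S) (q x) *\<^sub>R \<omega> (q x)))"
      by (rule integrable_bounded_linear[OF blv])
    then have "integrable lebesgue (\<lambda>x. v (indicator (f ` S) (q x) *\<^sub>R \<omega> (q x)))"
      by (subst integrable_completion) auto
    then show ?thesis
      unfolding set_integrable_def T'_def
      by (simp add: linear_simps[OF blv] indicator_vimage o_def)
  qed
  have S'l: "S' \<in> sets lebesgue" using S'b by simp
  \<comment> \<open>Integrands here are vector valued, hence the \<open>v\<close> around
    \<open>\<omega>\<close>. Integrability over the image is the known side; the pulled-back
    integrand inherits it together with the value.\<close>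
  note cv = has_absolute_integral_change_of_variables[OF S'l der inj, of "\<lambda>x. v (\<omega> (q x))" "integral T' (\<lambda>x. v (\<omega> (q x)))",
      unfolded gS det, THEN iffD2, OF _ conjI[OF i1 refl]]
  define D where "D = (\<lambda>z. indicator S z *\<^sub>R (cmod (deriv f z))\<^sup>2 *\<^sub>R \<omega> (f z))"
  have Dm: "D \<in> borel_measurable borel"
  proof -
    have c: "continuous_on U f" "continuous_on U (deriv f)"
      using U by (auto intro: holomorphic_on_imp_continuous_on holomorphic_deriv)
    have [measurable]: "(\<lambda>z. indicator U z *\<^sub>R f z) \<in> borel_measurable borel"
      "(\<lambda>z. indicator U z *\<^sub>R deriv f z) \<in> borel_measurable borel"
      using c U by (auto intro!: borel_measurable_continuous_on_indicator)
    note [measurable] = \<omega>m S(1)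
    have "D = (\<lambda>z. indicator S z *\<^sub>R (cmod (indicator U z *\<^sub>R deriv f z))\<^sup>2 *\<^sub>R
       (\<lambda>z. indicator (f ` S) z *\<^sub>R \<omega> z) (indicator U z *\<^sub>R f z))"
      using S(2) by (auto simp: D_def indicator_def fun_eq_iff)
    also have "\<dots> \<in> borel_measurable borel" by measurable
    finally show ?thesis .
  qed
  have qD: "(\<lambda>x. indicator S' x *\<^sub>R (cmod (deriv f (q x)))\<^sup>2 *\<^sub>R v (\<omega> (q (g x)))) = (\<lambda>x. v (D (q x)))"
    by (auto simp: D_def S'_def g_def indicator_def linear_simps[OF blv])
  have vDm: "(\<lambda>x. v (D (q x))) \<in> borel_measurable lborel"
    using Dm blv by (auto intro!: borel_measurable_continuous_on[OF linear_continuous_on[OF blv]])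
  have c1: "integrable lborel (\<lambda>x. v (D (q x)))"
    using cv vDm unfolding set_integrable_def qD by (simp add: integrable_completion)
  then have c2: "integrable lborel (\<lambda>x. D (q x))"
    using integrable_bounded_linear[OF blq c1] by simp
  then have "integrable lborel D"
    using Dm by (simp add: tr)
  then show ?A by (simp add: set_integrable_def D_def)
  have "v (LINT z:S|lborel. (cmod (deriv f z))\<^sup>2 *\<^sub>R \<omega> (f z)) = v (integral\<^sup>L lborel (\<lambda>x. D (q x)))"
    using tr(2)[OF Dm] by (simp only: set_lebesgue_integral_def D_def)
  also have "\<dots> = integral\<^sup>L lborel (\<lambda>x. v (D (q x)))"
    by (rule integral_bounded_linear[OF blv c2, symmetric])
  also have "\<dots> = integral\<^sup>L lebesgue (\<lambda>x. v (D (q x)))"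
    using vDm by (simp add: integral_completion)
  also have "\<dots> = integral S' (\<lambda>x. (cmod (deriv f (q x)))\<^sup>2 *\<^sub>R v (\<omega> (q (g x))))"
    using set_lebesgue_integral_eq_integral(2)[OF conjunct1[OF cv]]
    by (simp only: set_lebesgue_integral_def qD)
  also have "\<dots> = integral T' (\<lambda>x. v (\<omega> (q x)))"
    using cv by simp
  also have "\<dots> = (LINT x|lebesgue. v (indicator (f ` S) (q x) *\<^sub>R \<omega> (q x)))"
    using set_lebesgue_integral_eq_integral(2)[OF i1]
    by (simp add: set_lebesgue_integral_def T'_def indicator_vimage o_def linear_simps[OF blv])
  also have "\<dots> = (LINT x|lborel. v (indicator (f ` S) (q x) *\<^sub>R \<omega> (q x)))"
    using \<omega>m by (intro integral_completion borel_measurable_continuous_on[OF linear_continuous_on[OF blv]]) simp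
  also have "\<dots> = v (LINT x|lborel. indicator (f ` S) (q x) *\<^sub>R \<omega> (q x))"
    using int \<omega>m by (intro integral_bounded_linear[OF blv]) (simp add: set_integrable_def tr)
  also have "\<dots> = v (LINT z:f ` S|lborel. \<omega> z)"
    using \<omega>m by (simp add: set_lebesgue_integral_def tr)
  finally show ?B by (metis qv)
qed

section \<open>Charts and surface integrals\<close>

lemma inj_on_chart: "is_chart X c \<Longrightarrow> inj_on (snd c) (fst c)"
  unfolding is_chart_def
  by (metis homeomorphic_imp_injective_map openin_subset topspace_subtopology_subset)

lemma open_chart_image:
  assumes "is_chart X c" "openin X V" "V \<subseteq> fst c"
  shows "open (snd c ` V)"
proof -
  have "open_map (subtopology X (fst c)) (top_of_set (coord_image c)) (snd c)"
    using assms(1) unfolding is_chart_def by (blast intro: homeomorphic_imp_open_map)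
  moreover have "openin (subtopology X (fst c)) V"
    using assms by (auto simp: openin_subtopology_alt)
  ultimately have "openin (top_of_set (coord_image c)) (snd c ` V)"
    unfolding open_map_def by blast
  then show ?thesis
    using assms(1) unfolding is_chart_def by (meson openin_open_trans)
qed

lemma transition_apply:
  "is_chart X c \<Longrightarrow> q \<in> fst c \<Longrightarrow> transition c d (snd c q) = snd d q"
  unfolding transition_def by (simp add: the_inv_into_f_f inj_on_chart)

lemma open_overlap: "is_chart X c \<Longrightarrow> is_chart X d \<Longrightarrow> open (overlap c d)"
  unfolding overlap_def by (rule open_chart_image) (auto simp: is_chart_def)

lemma transition_in_overlap:
  "is_chart X c \<Longrightarrow> z \<in> overlap c d \<Longrightarrow> transition c d z \<in> overlap d c"
  unfolding overlap_def by (auto simp: transition_apply)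

lemma hol_charts_is_chart: "c \<in> hol_charts X \<A> \<Longrightarrow> is_chart X c"
  by (simp add: hol_charts_def)

lemma atlas_subset_hol_charts: "compact_riemann_surface X \<A> \<Longrightarrow> \<A> \<subseteq> hol_charts X \<A>"
  by (auto simp: compact_riemann_surface_def hol_charts_def)

text \<open>Membership in \<open>hol_charts\<close> tests compatibility with atlas charts only. Two
  charts of the maximal atlas are therefore compared near a point through an atlas chart
  \<open>e\<close> containing that point.\<close>

lemma transition_holomorphic:
  assumes X: "compact_riemann_surface X \<A>" and c: "c \<in> hol_charts X \<A>" and d: "d \<in> hol_charts X \<A>"
  shows "transition c d holomorphic_on overlap c d"
proof -
  have "transition c d field_differentiable at z" if z: "z \<in> overlap c d" for z
  proof -
    from z obtain q where q: "q \<in> fst c" "q \<in> fst d" "z = snd c q"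
      by (auto simp: overlap_def)
    note cd = hol_charts_is_chart[OF c] hol_charts_is_chart[OF d]
    have "q \<in> topspace X"
      using cd(1) q(1) openin_subset by (auto simp: is_chart_def)
    then obtain e where e: "e \<in> \<A>" "q \<in> fst e"
      using X unfolding compact_riemann_surface_def by blast
    have ie: "is_chart X e"
      using X e(1) by (auto simp: compact_riemann_surface_def)
    define V where "V = snd c ` (fst c \<inter> fst d \<inter> fst e)"
    have V: "open V"
      unfolding V_def using cd ie by (intro open_chart_image[of X]) (auto simp: is_chart_def)
    have hol: "transition c e holomorphic_on overlap c e" "transition e d holomorphic_on overlap e d"
      using c d e(1) by (auto simp: hol_charts_def hol_compatible_def)
    have "(transition e d \<circ> transition c e) holomorphic_on V"
      by (rule holomorphic_on_compose_gen[OF holomorphic_on_subset[OF hol(1)] hol(2)])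
        (auto simp: V_def overlap_def transition_apply[OF cd(1)])
    then have "transition c d holomorphic_on V"
      by (rule holomorphic_transform)
        (auto simp: V_def transition_apply[OF cd(1)] transition_apply[OF ie])
    then show ?thesis
      using V q e holomorphic_on_imp_differentiable_at by (fastforce simp: V_def)
  qed
  then show ?thesis
    by (simp add: field_differentiable_at_within holomorphic_onI)
qed

text \<open>Chain rule on the triple overlap. This cocycle relation is what makes quantities defined
  by pullback from one chart consistent between all charts.\<close>

lemma deriv_transition_compose:
  assumes X: "compact_riemann_surface X \<A>"
    and c: "c \<in> hol_charts X \<A>" and d: "d \<in> hol_charts X \<A>" and e: "e \<in> hol_charts X \<A>"
    and z: "z \<in> overlap c d" "z \<in> overlap c e"
  shows "deriv (transition c e) z = deriv (transition d e) (transition c d z) * deriv (transition c d) z"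
proof -
  note ch = hol_charts_is_chart[OF c] hol_charts_is_chart[OF d] hol_charts_is_chart[OF e]
  from z obtain q where q: "q \<in> fst c" "q \<in> fst d" "q \<in> fst e" "z = snd c q"
    using inj_on_chart[OF ch(1)] by (auto simp: overlap_def inj_on_def)
  define V where "V = snd c ` (fst c \<inter> fst d \<inter> fst e)"
  have V: "open V" "z \<in> V"
    using q ch unfolding V_def by (auto intro!: open_chart_image[of X] simp: is_chart_def)
  have "\<forall>\<^sub>F w in nhds z. transition c e w = (transition d e \<circ> transition c d) w"
    using eventually_nhds_in_open[OF V]
    by eventually_elim (auto simp: V_def transition_apply[OF ch(1)] transition_apply[OF ch(2)])
  then have "deriv (transition c e) z = deriv (transition d e \<circ> transition c d) z"
    by (rule deriv_cong_ev) simp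
  also have "\<dots> = deriv (transition d e) (transition c d z) * deriv (transition c d) z"
  proof (rule deriv_chain)
    show "transition c d field_differentiable at z"
      using transition_holomorphic[OF X c d] open_overlap[OF ch(1,2)] z(1)
      by (rule holomorphic_on_imp_differentiable_at)
    have "transition c d z \<in> overlap d e"
      using q by (auto simp: overlap_def transition_apply[OF ch(1)])
    then show "transition d e field_differentiable at (transition c d z)"
      using transition_holomorphic[OF X d e] open_overlap[OF ch(2,3)] holomorphic_on_imp_differentiable_at
      by blast
  qed
  finally show ?thesis .
qed

lemma deriv_transition_self:
  assumes c: "is_chart X c" and z: "z \<in> coord_image c"
  shows "deriv (transition c c) z = 1"
proof -
  have o: "open (coord_image c)"
    using c by (simp add: is_chart_def)
  have "\<forall>\<^sub>F w in nhds z. transition c c w = w"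
    using eventually_nhds_in_open[OF o z]
    by eventually_elim (auto simp: coord_image_def transition_apply[OF c])
  then have "deriv (transition c c) z = deriv (\<lambda>w. w) z"
    by (rule deriv_cong_ev) simp
  then show ?thesis by simp
qed

text \<open>Going to \<open>d\<close> and back is the identity, so the cocycle relation exhibits the
  derivative as a factor of 1.\<close>

lemma deriv_transition_nonzero:
  assumes X: "compact_riemann_surface X \<A>"
    and c: "c \<in> hol_charts X \<A>" and d: "d \<in> hol_charts X \<A>" and z: "z \<in> overlap c d"
  shows "deriv (transition c d) z \<noteq> 0"
proof -
  have "z \<in> overlap c c" "z \<in> coord_image c"
    using z by (auto simp: overlap_def coord_image_def)
  then show ?thesis
    using deriv_transition_compose[OF X c d c z] deriv_transition_self[OF hol_charts_is_chart[OF c]] by auto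
qed

lemma inj_on_transition:
  "is_chart X c \<Longrightarrow> is_chart X d \<Longrightarrow> inj_on (transition c d) (overlap c d)"
  unfolding inj_on_def overlap_def
  by (auto simp: transition_apply) (metis inj_on_chart inj_onD)

lemma overlap_transition_iff:
  assumes "is_chart X c" "is_chart X d" and z: "z \<in> overlap c d"
  shows "transition c d z \<in> overlap d e \<longleftrightarrow> z \<in> overlap c e"
    and "transition d e (transition c d z) = transition c e z"
proof -
  obtain q where q: "q \<in> fst c" "q \<in> fst d" "z = snd c q"
    using z by (auto simp: overlap_def)
  have "snd d q \<in> overlap d e \<longleftrightarrow> q \<in> fst e" "snd c q \<in> overlap c e \<longleftrightarrow> q \<in> fst e"
    using q assms(1,2)[THEN inj_on_chart] by (auto simp: overlap_def inj_on_def)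
  then show "transition c d z \<in> overlap d e \<longleftrightarrow> z \<in> overlap c e"
    "transition d e (transition c d z) = transition c e z"
    using q assms by (auto simp: transition_apply)
qed

text \<open>Only one chart carries the support, so any admissible decomposition can be pushed forward
  to it by the transition maps.\<close>

lemma surface_integral_supported_in_chart:
  assumes X: "compact_riemann_surface X \<A>" and W: "W \<in> hol_charts X \<A>"
    and law: "\<And>c z. c \<in> hol_charts X \<A> \<Longrightarrow> z \<in> overlap c W \<Longrightarrow>
      \<omega> c z = (cmod (deriv (transition c W) z))\<^sup>2 *\<^sub>R \<omega> W (transition c W z)"
    and supp: "\<And>c z. c \<in> hol_charts X \<A> \<Longrightarrow> z \<in> coord_image c \<Longrightarrow> z \<notin> overlap c W \<Longrightarrow> \<omega> c z = 0"
    and int: "set_integrable lborel (coord_image W) (\<omega> W)"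
  shows "surface_integral X \<A> \<omega> = (LINT z:coord_image W|lborel. \<omega> W z)"
  unfolding surface_integral_def
proof (rule the_equality)
  have chW: "is_chart X W" using W by (rule hol_charts_is_chart)
  show "has_surface_integral X \<A> \<omega> (LINT z:coord_image W|lborel. \<omega> W z)"
  proof -
    have "\<exists>F. finite F \<and> F \<subseteq> fst ` \<A> \<and> topspace X \<subseteq> \<Union>F"
      using X unfolding compact_riemann_surface_def compact_space_def compactin_def is_chart_def
      by (smt (verit, best) imageE order_refl)
    then obtain F0 where F0: "finite F0" "F0 \<subseteq> fst ` \<A>" "topspace X \<subseteq> \<Union>F0" by blast
    obtain F where F: "finite F" "F \<subseteq> \<A>" "F0 = fst ` F"
      using finite_subset_image[OF F0(1,2)] by blast
    obtain xs where xs: "set xs = F" using finite_list[OF F(1)] by blast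
    \<comment> \<open>Existence of a decomposition: with \<open>W\<close> at index 0,
      \<open>disjointed\<close> makes all of \<open>fst W\<close> the first piece and keeps every
      later piece off it, so only the first piece contributes to the integral.\<close>
    define c where "c = (\<lambda>k. (W # xs) ! k)"
    define m where "m = Suc (length xs)"
    define E where "E = disjointed (\<lambda>k. fst (c k))"
    have cm: "c k \<in> hol_charts X \<A>" if "k < m" for k
      using that nth_mem[of k "W # xs"] W xs F(2) atlas_subset_hol_charts[OF X]
      by (auto simp: c_def m_def)
    have Esub: "E k \<subseteq> fst (c k)" for k
      unfolding E_def by (rule disjointed_subset)
    have E0: "E 0 = fst W"
      by (simp add: E_def disjointed_def c_def)
    have EW: "E k \<inter> fst W = {}" if "0 < k" for k
      using that E0 disjoint_family_disjointed[of "\<lambda>k. fst (c k)"]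
      unfolding E_def disjoint_family_on_def by (metis Int_commute UNIV_I less_not_refl)
    have cover: "(\<Union>k<m. E k) = topspace X"
    proof -
      have "c ` {..<m} = (!) (W # xs) ` {0..<length (W # xs)}"
        unfolding c_def m_def lessThan_atLeast0 length_Cons ..
      also have "\<dots> = set (W # xs)"
        unfolding nth_image[OF order_refl] take_all[OF order_refl] ..
      finally have cim: "c ` {..<m} = insert W F" using xs by (simp only: list.set)
      have "(\<Union>k<m. E k) = (\<Union>k<m. fst (c k))"
        unfolding E_def using finite_UN_disjointed_eq[of "\<lambda>k. fst (c k)" m] by (simp add: lessThan_atLeast0)
      also have "\<dots> = \<Union> (fst ` insert W F)"
        unfolding cim[symmetric] by (simp add: image_image)
      also have "\<dots> = topspace X"
      proof
        have "openin X (fst d)" if "d \<in> insert W F" for d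
          using that chW F(2) X by (auto simp: compact_riemann_surface_def is_chart_def)
        then show "\<Union> (fst ` insert W F) \<subseteq> topspace X"
          using openin_subset by blast
        show "topspace X \<subseteq> \<Union> (fst ` insert W F)"
          using F0(3) F(3) by auto
      qed
      finally show ?thesis .
    qed
    have mE: "snd (c k) ` E k \<in> sets borel" if k: "k < m" for k
    proof -
      have ch: "is_chart X (c i)" if "i < m" for i using cm[OF that] by (rule hol_charts_is_chart)
      \<comment> \<open>A piece made disjoint from its predecessors is a difference of two open sets
        in its coordinate, hence Borel.\<close>
      have "snd (c k) ` E k = snd (c k) ` fst (c k) - snd (c k) ` (fst (c k) \<inter> (\<Union>i\<in>{0..<k}. fst (c i)))"
        unfolding E_def disjointed_def using inj_on_chart[OF ch[OF k]] by (auto simp: inj_on_def)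
      moreover have "open (snd (c k) ` fst (c k))"
        "open (snd (c k) ` (fst (c k) \<inter> (\<Union>i\<in>{0..<k}. fst (c i))))"
        using ch k by (auto intro!: open_chart_image[OF ch[OF k]] openin_Int openin_clauses(3) simp: is_chart_def)
      ultimately show ?thesis by simp
    qed
    have zero: "\<omega> (c k) z = 0" if "k < m" "0 < k" "z \<in> snd (c k) ` E k" for k z
    proof (rule supp[OF cm[OF that(1)]])
      show "z \<in> coord_image (c k)"
        using that(3) Esub by (auto simp: coord_image_def)
      show "z \<notin> overlap (c k) W"
        using that(3) Esub[of k] EW[OF that(2)] inj_on_chart[OF hol_charts_is_chart[OF cm[OF that(1)]]]
        by (auto simp: overlap_def inj_on_def)
    qed
    have c0: "c 0 = W" by (simp add: c_def)
    have i0: "(\<lambda>z. indicator (snd (c k) ` E k) z *\<^sub>R \<omega> (c k) z) = (\<lambda>z. 0)" if "k < m" "0 < k" for k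
      using zero[OF that] by (auto simp: indicator_def)
    have ik: "set_integrable lborel (snd (c k) ` E k) (\<omega> (c k))" if "k < m" for k
    proof (cases "k = 0")
      case True
      then show ?thesis using int by (simp add: c0 E0 coord_image_def)
    next
      case False
      then show ?thesis using i0[OF that] by (simp add: set_integrable_def)
    qed
    have "(LINT z:snd (c k) ` E k|lborel. \<omega> (c k) z) = (if k = 0 then LINT z:coord_image W|lborel. \<omega> W z else 0)"
      if "k < m" for k
      using i0[OF that] by (auto simp: c0 E0 coord_image_def set_lebesgue_integral_def)
    then have s: "(LINT z:coord_image W|lborel. \<omega> W z) = (\<Sum>k<m. LINT z:snd (c k) ` E k|lborel. \<omega> (c k) z)"
      by (simp add: m_def)
    show ?thesis
      unfolding has_surface_integral_def
      using cm Esub mE ik cover s disjoint_family_on_mono[OF subset_UNIV disjoint_family_disjointed, of "\<lambda>k. fst (c k)" "{..<m}"]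
      by (intro exI[of _ m] exI[of _ c] exI[of _ E]) (auto simp: E_def)
  qed
  fix I assume "has_surface_integral X \<A> \<omega> I"
  then obtain m c E where
    cE: "\<And>k. k < (m::nat) \<Longrightarrow> c k \<in> hol_charts X \<A> \<and> E k \<subseteq> fst (c k) \<and> snd (c k) ` E k \<in> sets borel"
    and dis: "disjoint_family_on E {..<m}" and cov: "(\<Union>k<m. E k) = topspace X"
    and I: "I = (\<Sum>k<m. LINT z:snd (c k) ` E k|lborel. \<omega> (c k) z)"
    unfolding has_surface_integral_def by blast
  \<comment> \<open>Uniqueness: for an arbitrary decomposition, \<open>T k\<close> is the trace of
    its k-th piece on \<open>W\<close>, in the coordinate of \<open>W\<close>. These traces
    partition \<open>coord_image W\<close>, and each piece integral will be moved to its
    trace.\<close>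
  define T where "T k = snd W ` (E k \<inter> fst W)" for k
  have piece: "(LINT z:snd (c k) ` E k|lborel. \<omega> (c k) z) = (LINT z:T k|lborel. \<omega> W z) \<and> T k \<in> sets borel"
    if k: "k < m" for k
  proof -
    note ck = cE[OF k]
    have ch: "is_chart X (c k)" using ck hol_charts_is_chart by blast
    note op = open_overlap[OF ch chW] open_overlap[OF chW ch]
    define S where "S = snd (c k) ` (E k \<inter> fst W)"
    have S_eq: "S = snd (c k) ` E k \<inter> overlap (c k) W"
      unfolding S_def overlap_def using ck inj_on_chart[OF ch] by (auto simp: inj_on_def)
    have S: "S \<in> sets borel" unfolding S_eq using ck op(1) by (intro sets.Int) auto
    have fS: "transition (c k) W ` S = T k"
      unfolding S_def T_def image_image using ck by (intro image_cong) (auto simp: transition_apply[OF ch])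
    \<comment> \<open>Borel measurability of \<open>T k\<close> is obtained by writing this image as
      a preimage under the transition in the opposite direction, from \<open>W\<close> to
      \<open>c k\<close>, extended by zero off the overlap.\<close>
    have T_eq: "T k = overlap W (c k) \<inter> (\<lambda>w. indicator (overlap W (c k)) w *\<^sub>R transition W (c k) w) -` (snd (c k) ` E k)"
    proof -
      have "snd W q \<in> T k \<longleftrightarrow> snd (c k) q \<in> snd (c k) ` E k" if "q \<in> fst W" "q \<in> fst (c k)" for q
        unfolding T_def using that ck inj_on_image_mem_iff[OF inj_on_chart[OF ch], of q "E k"]
          inj_on_image_mem_iff[OF inj_on_chart[OF chW], of q "E k \<inter> fst W"] by auto
      moreover have "T k \<subseteq> overlap W (c k)"
        unfolding T_def overlap_def using ck by auto
      ultimately show ?thesis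
        unfolding overlap_def by (auto simp: transition_apply[OF chW] indicator_def)
    qed
    have "(\<lambda>w. indicator (overlap W (c k)) w *\<^sub>R transition W (c k) w) \<in> borel_measurable borel"
      using transition_holomorphic[OF X W, of "c k"] ck op
      by (intro borel_measurable_continuous_on_indicator holomorphic_on_imp_continuous_on) auto
    from measurable_sets[OF this, of "snd (c k) ` E k"] have T: "T k \<in> sets borel"
      using ck op by (simp add: T_eq)
    have intT: "set_integrable lborel (T k) (\<omega> W)"
      by (rule set_integrable_subset[OF int]) (use T in \<open>auto simp: T_def coord_image_def\<close>)
    have "(LINT z:snd (c k) ` E k|lborel. \<omega> (c k) z) = (LINT z:S|lborel. \<omega> (c k) z)"
      unfolding set_lebesgue_integral_def
    proof (rule Bochner_Integration.integral_cong)
      fix z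
      show "indicator (snd (c k) ` E k) z *\<^sub>R \<omega> (c k) z = indicator S z *\<^sub>R \<omega> (c k) z"
        using supp[of "c k" z] ck by (auto simp: S_eq indicator_def coord_image_def)
    qed simp
    also have "\<dots> = (LINT z:S|lborel. (cmod (deriv (transition (c k) W) z))\<^sup>2 *\<^sub>R \<omega> W (transition (c k) W z))"
      using S law[of "c k"] ck by (intro set_lebesgue_integral_cong) (auto simp: S_eq)
    also have "\<dots> = (LINT z:T k|lborel. \<omega> W z)"
    proof -
      have ov: "S \<subseteq> overlap (c k) W" by (simp add: S_eq)
      have "c k \<in> hol_charts X \<A>" using ck by blast
      from holomorphic_change_of_variables(2)[OF op(1) transition_holomorphic[OF X this W] S ov
          inj_on_subset[OF inj_on_transition[OF ch chW] ov], unfolded fS, OF T intT]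
      show ?thesis .
    qed
    finally show ?thesis using T by simp
  qed
  have disT: "disjoint_family_on T {..<m}"
    using dis inj_on_chart[OF chW] unfolding disjoint_family_on_def T_def inj_on_def by blast
  have covT: "(\<Union>k<m. T k) = coord_image W"
  proof -
    have "fst W \<subseteq> (\<Union>k<m. E k)"
      unfolding cov using chW openin_subset by (auto simp: is_chart_def)
    then show ?thesis unfolding T_def coord_image_def by blast
  qed
  have "I = (\<Sum>k<m. LINT z:T k|lborel. \<omega> W z)"
    unfolding I using piece by simp
  also have "\<dots> = (LINT z:(\<Union>k<m. T k)|lborel. \<omega> W z)"
  proof (rule set_integral_finite_Union[symmetric])
    show "set_integrable lborel (T k) (\<omega> W)" if "k \<in> {..<m}" for k
      by (rule set_integrable_subset[OF int]) (use that piece in \<open>auto simp: T_def coord_image_def\<close>)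
  qed (use disT piece in auto)
  finally show "I = (LINT z:coord_image W|lborel. \<omega> W z)"
    by (simp add: covT)
qed

section \<open>Twist deformations\<close>

lemma annulus_iff [simp]: "z \<in> annulus r1 r2 \<longleftrightarrow> r1 < cmod z \<and> cmod z < r2"
  by (simp add: annulus_def)

lemma open_annulus: "open (annulus r1 r2)"
  unfolding annulus_def by (intro open_Collect_conj open_Collect_less continuous_intros)

section \<open>The cutoff function and the Beltrami differential of the twist\<close>

lemma twist_cutoff_deriv:
  assumes "twist_cutoff r1 r2 h" "r1 < r" "r < r2"
  shows "(h has_real_derivative deriv h r) (at r)" "isCont (deriv h) r"
proof -
  have 1: "((deriv ^^ k) h) differentiable (at r)" for k
    using assms by (auto simp: twist_cutoff_def)
  show "(h has_real_derivative deriv h r) (at r)"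
    using 1[of 0] by (metis DERIV_deriv_iff_real_differentiable funpow_0)
  show "isCont (deriv h) r"
    using 1[of 1] by (simp add: differentiable_imp_continuous_within)
qed

text \<open>Smoothness on an open interval gives no bound near its ends. Confining the support of
  the derivative to a compact subinterval supplies the boundedness and integrability used
  later.\<close>

lemma twist_cutoff_ends:
  assumes "twist_cutoff r1 r2 h" "r1 < r2"
  obtains s1 s2 where "r1 < s1" "s1 < s2" "s2 < r2" "\<And>r. r1 < r \<Longrightarrow> r \<le> s1 \<Longrightarrow> h r = 0"
    "\<And>r. s2 \<le> r \<Longrightarrow> r < r2 \<Longrightarrow> h r = 1"
    "\<And>r. r1 < r \<Longrightarrow> r < r2 \<Longrightarrow> r \<notin> {s1..s2} \<Longrightarrow> deriv h r = 0"
proof -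
  obtain e where e: "e > 0" "\<And>r. r1 < r \<Longrightarrow> r < r1 + e \<Longrightarrow> h r = 0" "\<And>r. r2 - e < r \<Longrightarrow> r < r2 \<Longrightarrow> h r = 1"
    using assms by (auto simp: twist_cutoff_def)
  \<comment> \<open>Half of \<open>e\<close> keeps the closed end points inside the zones where
    \<open>h\<close> is constant; a third of the width keeps \<open>r1 + d\<close> below
    \<open>r2 - d\<close>.\<close>
  define d where "d = min (e/2) ((r2 - r1)/3)"
  have d: "0 < d" "d < e" "3 * d \<le> r2 - r1" using e(1) assms(2) by (auto simp: d_def min_def field_simps)
  show ?thesis
  proof
    show "r1 < r1 + d" "r1 + d < r2 - d" "r2 - d < r2" using d by auto
    show "h r = 0" if "r1 < r" "r \<le> r1 + d" for r using that d e by auto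
    show "h r = 1" if "r2 - d \<le> r" "r < r2" for r using that d e by auto
    show "deriv h r = 0" if r: "r1 < r" "r < r2" "r \<notin> {r1 + d..r2 - d}" for r
    proof -
      have "r < r1 + e \<or> r2 - e < r" using r d by auto
      then obtain k :: real where "\<forall>\<^sub>F x in nhds r. h x = k"
      proof
        assume "r < r1 + e"
        then have "\<forall>\<^sub>F x in nhds r. x \<in> {r1<..<r1+e}" using r by (intro eventually_nhds_in_open) auto
        then have "\<forall>\<^sub>F x in nhds r. h x = 0" by eventually_elim (use e in auto)
        then show ?thesis by (rule that)
      next
        assume "r2 - e < r"
        then have "\<forall>\<^sub>F x in nhds r. x \<in> {r2-e<..<r2}" using r by (intro eventually_nhds_in_open) auto
        then have "\<forall>\<^sub>F x in nhds r. h x = 1" by eventually_elim (use e in auto)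
        then show ?thesis by (rule that)
      qed
      then have "deriv h r = deriv (\<lambda>_. k) r" by (rule deriv_cong_ev) simp
      then show ?thesis by simp
    qed
  qed
qed

text \<open>The trivialization rotates every circle around 0 into itself by an angle depending only
  on the modulus. Points with equal images thus share their modulus and rotation factor, which gives
  injectivity, and the inverse is the rotation by the opposite angle.\<close>

lemma twist_family_eq:
  assumes "z \<in> annulus r1 r2"
  shows "twist_family h r1 r0 r2 z \<tau> = exp (- \<i> * of_real (\<tau> / r0 * h (cmod z))) * z"
proof -
  have cm: "cmod (twist_trivialization h r0 w \<tau>) = cmod w" for w
    by (simp add: twist_trivialization_def norm_mult)
  let ?w = "exp (- \<i> * of_real (\<tau> / r0 * h (cmod z))) * z"
  have "cmod ?w = cmod z" by (simp add: norm_mult)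
  then have "twist_trivialization h r0 ?w \<tau> = z"
    unfolding twist_trivialization_def
    by (simp del: of_real_mult of_real_divide add: mult.assoc[symmetric] exp_add[symmetric] flip: exp_minus)
  moreover have "inj_on (\<lambda>w. twist_trivialization h r0 w \<tau>) (annulus r1 r2)"
  proof (rule inj_onI)
    fix w w' assume eq: "twist_trivialization h r0 w \<tau> = twist_trivialization h r0 w' \<tau>"
    then have "cmod w = cmod w'" by (metis cm)
    then show "w = w'" using eq by (simp add: twist_trivialization_def)
  qed
  moreover have "?w \<in> annulus r1 r2" using assms by (simp add: norm_mult)
  ultimately show ?thesis
    unfolding twist_family_def by (metis inv_into_f_f)
qed

text \<open>The velocity of the family at time 0 is -i/r0 h(|z|) z. As z is holomorphic, only the
  factor h(|z|) feels the conjugate derivative, contributing h'(|z|) z / (2|z|).\<close>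

lemma kodaira_spencer_twist_family:
  assumes h: "twist_cutoff r1 r2 h" and r: "0 < r1" and z: "z \<in> annulus r1 r2"
  shows "kodaira_spencer (twist_family h r1 r0 r2) z =
    - \<i> / (2 * of_real r0) * of_real (deriv h (cmod z)) * z\<^sup>2 / of_real (cmod z)"
proof -
  have v: "vector_derivative (\<lambda>\<tau>. twist_family h r1 r0 r2 w \<tau>) (at 0) = - \<i> / of_real r0 * of_real (h (cmod w)) * w"
    if "w \<in> annulus r1 r2" for w
  proof -
    have "((\<lambda>\<tau>. exp (- \<i> * of_real (\<tau> / r0 * h (cmod w))) * w) has_vector_derivative
        - \<i> / of_real r0 * of_real (h (cmod w)) * w) (at 0)"
    proof -
      have "((\<lambda>s. exp (- \<i> * (s * of_real (inverse r0) * of_real (h (cmod w)))) * w) has_field_derivative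
          - \<i> / of_real r0 * of_real (h (cmod w)) * w) (at (of_real 0))"
        by (auto intro!: derivative_eq_intros simp: divide_inverse)
      from has_vector_derivative_real_field[OF this] show ?thesis by (simp add: divide_inverse)
    qed
    then show ?thesis
      by (simp add: twist_family_eq[OF that] vector_derivative_at)
  qed
  define D where "D = (\<lambda>u. - \<i> / of_real r0 * (of_real (deriv h (cmod z) * (z \<bullet> u / cmod z)) * z + of_real (h (cmod z)) * u))"
  have z0: "z \<noteq> 0" and rz: "r1 < cmod z" "cmod z < r2" using r z by auto
  have "((\<lambda>w. h (cmod w)) has_derivative (\<lambda>u. deriv h (cmod z) * (z \<bullet> u / cmod z))) (at z)"
  proof -
    have "(norm has_derivative (\<lambda>u. z \<bullet> u / cmod z)) (at z)"
      using has_derivative_norm[OF z0] by (simp add: sgn_div_norm inner_commute divide_inverse mult.commute)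
    from has_derivative_compose[OF this, of h "(*) (deriv h (cmod z))"]
    show ?thesis using twist_cutoff_deriv(1)[OF h rz]
      by (simp add: has_field_derivative_def)
  qed
  then have "((\<lambda>w. - \<i> / of_real r0 * of_real (h (cmod w)) * w) has_derivative D) (at z)"
  proof -
    assume "((\<lambda>w. h (cmod w)) has_derivative (\<lambda>u. deriv h (cmod z) * (z \<bullet> u / cmod z))) (at z)"
    then have "((\<lambda>w. of_real (h (cmod w)) * w) has_derivative
       (\<lambda>u. of_real (deriv h (cmod z) * (z \<bullet> u / cmod z)) * z + of_real (h (cmod z)) * u)) (at z)"
      by (auto intro!: has_derivative_eq_rhs[OF has_derivative_mult] has_derivative_of_real simp: algebra_simps)
    from has_derivative_mult_right[OF this, of "- \<i> / of_real r0"]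
    show ?thesis by (simp only: D_def mult.assoc)
  qed
  then have "((\<lambda>w. vector_derivative (\<lambda>\<tau>. twist_family h r1 r0 r2 w \<tau>) (at 0)) has_derivative D) (at z)"
    by (rule has_derivative_transform_within_open[OF _ open_annulus z]) (simp add: v)
  then have "frechet_derivative (\<lambda>w. vector_derivative (\<lambda>\<tau>. twist_family h r1 r0 r2 w \<tau>) (at 0)) (at z) = D"
    by (simp add: frechet_derivative_at[symmetric])
  then have "kodaira_spencer (twist_family h r1 r0 r2) z = (D 1 + \<i> * D \<i>) / 2"
    by (simp add: kodaira_spencer_def wirtinger_bar_def)
  also have "\<dots> = - \<i> / of_real r0 / 2 * (of_real (deriv h (cmod z) * (Re z / cmod z)) +
      \<i> * of_real (deriv h (cmod z) * (Im z / cmod z))) * z"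
  proof -
    \<comment> \<open>The terms carrying \<open>H\<close> cancel because 1 + i * i = 0: the
      conjugate derivative of z vanishes.\<close>
    have "(k * (A * z + H * 1) + \<i> * (k * (B * z + H * \<i>))) / 2 = k / 2 * (A + \<i> * B) * z" for k A B H :: complex
      by (simp add: field_simps)
    then show ?thesis
      unfolding D_def complex_inner_1_right complex_inner_i_right .
  qed
  also have "of_real (deriv h (cmod z) * (Re z / cmod z)) + \<i> * of_real (deriv h (cmod z) * (Im z / cmod z)) =
      of_real (deriv h (cmod z)) / of_real (cmod z) * z"
    (is "?l = ?c * z")
  proof -
    have "?l = ?c * (of_real (Re z) + \<i> * of_real (Im z))"
      by (simp add: algebra_simps add_divide_distrib)
    then show ?thesis by (simp only: complex_eq[symmetric])
  qed
  finally have "kodaira_spencer (twist_family h r1 r0 r2) z =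
      - \<i> / of_real r0 / 2 * (of_real (deriv h (cmod z)) / of_real (cmod z) * z) * z" .
  then show ?thesis by (simp add: power2_eq_square mult_ac)
qed

lemma continuous_on_deriv_cutoff:
  assumes "twist_cutoff r1 r2 h"
  shows "continuous_on (annulus r1 r2) (\<lambda>z. deriv h (cmod z))"
proof -
  have "continuous_on {r1<..<r2} (deriv h)"
    using twist_cutoff_deriv(2)[OF assms] by (intro continuous_at_imp_continuous_on) auto
  then show ?thesis
    by (rule continuous_on_compose2) (auto intro!: continuous_intros)
qed

lemma continuous_on_kodaira_spencer:
  assumes h: "twist_cutoff r1 r2 h" and r: "0 < r1"
  shows "continuous_on (annulus r1 r2) (kodaira_spencer (twist_family h r1 r0 r2))"
proof -
  have "continuous_on (annulus r1 r2) (\<lambda>z. - \<i> / (2 * of_real r0) * of_real (deriv h (cmod z)) * z\<^sup>2 / of_real (cmod z))"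
    by (intro continuous_intros continuous_on_deriv_cutoff[OF h]) (use r in auto)
  then show ?thesis
    by (rule continuous_on_eq) (simp only: kodaira_spencer_twist_family[OF h r])
qed

lemma bounded_kodaira_spencer:
  assumes h: "twist_cutoff r1 r2 h" and r: "0 < r1" "r1 < r2"
  obtains K where "K \<ge> 0" "\<And>z. z \<in> annulus r1 r2 \<Longrightarrow> cmod (kodaira_spencer (twist_family h r1 r0 r2) z) \<le> K"
proof -
  obtain s1 s2 where s: "r1 < s1" "s1 < s2" "s2 < r2"
    "\<And>r. r1 < r \<Longrightarrow> r < r2 \<Longrightarrow> r \<notin> {s1..s2} \<Longrightarrow> deriv h r = 0"
    using twist_cutoff_ends[OF h r(2)] by metis
  have "continuous_on {s1..s2} (deriv h)"
    using twist_cutoff_deriv(2)[OF h] s by (intro continuous_at_imp_continuous_on) auto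
  then have "bounded (deriv h ` {s1..s2})"
    by (intro compact_imp_bounded compact_continuous_image) auto
  then obtain M where M: "M > 0" "\<And>x. x \<in> {s1..s2} \<Longrightarrow> \<bar>deriv h x\<bar> \<le> M"
    unfolding bounded_pos by auto
  have M': "\<bar>deriv h x\<bar> \<le> M" if "r1 < x" "x < r2" for x
    using M s(4)[OF that] by (cases "x \<in> {s1..s2}") auto
  show ?thesis
  proof (rule that[of "M * r2 / (2 * \<bar>r0\<bar>)"])
    show "M * r2 / (2 * \<bar>r0\<bar>) \<ge> 0" using M(1) r by simp
    fix z assume z: "z \<in> annulus r1 r2"
    then have "z \<noteq> 0" using r by auto
    then have "cmod (kodaira_spencer (twist_family h r1 r0 r2) z) = \<bar>deriv h (cmod z)\<bar> * cmod z / (2 * \<bar>r0\<bar>)"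
      using r by (simp add: kodaira_spencer_twist_family[OF h r(1) z] norm_mult norm_divide norm_power power2_eq_square)
    also have "\<dots> \<le> M * r2 / (2 * \<bar>r0\<bar>)"
      using M' M(1) z r by (intro divide_right_mono mult_mono) auto
    finally show "cmod (kodaira_spencer (twist_family h r1 r0 r2) z) \<le> M * r2 / (2 * \<bar>r0\<bar>)" .
  qed
qed

text \<open>Both sides are pulled back from \<open>W\<close>, so the cocycle relation identifies
  them; at points outside \<open>W\<close> both are 0.\<close>

lemma twist_beltrami_transform:
  assumes X: "compact_riemann_surface X \<A>" and W: "W \<in> hol_charts X \<A>"
    and c: "c \<in> hol_charts X \<A>" and d: "d \<in> hol_charts X \<A>" and z: "z \<in> overlap c d"
  shows "twist_beltrami W h r1 r0 r2 c z = twist_beltrami W h r1 r0 r2 d (transition c d z) *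
             cnj (deriv (transition c d) z) / deriv (transition c d) z"
proof -
  note ch = hol_charts_is_chart[OF c] hol_charts_is_chart[OF d]
  show ?thesis
    using deriv_transition_compose[OF X c d W z]
    by (simp add: twist_beltrami_def overlap_transition_iff[OF ch z])
qed

text \<open>The factor \<open>cnj d / d\<close> of a coordinate change has modulus 1, so a bound in
  the coordinate of \<open>W\<close> serves all charts at once. Measurability holds because the
  expression is continuous on the open overlap with \<open>W\<close> and 0 elsewhere.\<close>

lemma twist_beltrami_in_beltrami_differentials:
  assumes X: "compact_riemann_surface X \<A>" and W: "twist_annulus X \<A> P u L r1 r0 r2 W"
    and h: "twist_cutoff r1 r2 h"
  shows "twist_beltrami W h r1 r0 r2 \<in> beltrami_differentials X \<A> P"
proof -
  let ?ks = "kodaira_spencer (twist_family h r1 r0 r2)"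
  have W': "W \<in> hol_charts X \<A>" "fst W \<inter> P = {}" "coord_image W = annulus r1 r2" and r: "0 < r1" "r1 < r2"
    using W by (auto simp: twist_annulus_def)
  note chW = hol_charts_is_chart[OF W'(1)]
  have im: "transition c W z \<in> annulus r1 r2" if "is_chart X c" "z \<in> overlap c W" for c z
    using transition_in_overlap[OF that] W'(3) by (auto simp: overlap_def coord_image_def)
  obtain K where K: "K \<ge> 0" "\<And>z. z \<in> annulus r1 r2 \<Longrightarrow> cmod (?ks z) \<le> K"
    using bounded_kodaira_spencer[OF h r] by metis
  have "cmod (twist_beltrami W h r1 r0 r2 c z) \<le> K" if "c \<in> hol_charts X \<A>" for c z
    using K im[OF hol_charts_is_chart[OF that]]
    by (auto simp: twist_beltrami_def norm_mult norm_divide)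
  moreover have "set_borel_measurable borel (punctured_image P c) (twist_beltrami W h r1 r0 r2 c)"
    if c: "c \<in> hol_charts X \<A>" for c
  proof -
    note ch = hol_charts_is_chart[OF c]
    note op = open_overlap[OF ch chW]
    have sub: "overlap c W \<subseteq> punctured_image P c"
      using W'(2) by (auto simp: overlap_def punctured_image_def)
    have hol: "transition c W holomorphic_on overlap c W"
      using X c W'(1) by (rule transition_holomorphic)
    have "continuous_on (overlap c W) (\<lambda>z. ?ks (transition c W z) *
           cnj (deriv (transition c W) z) / deriv (transition c W) z)"
      using hol holomorphic_deriv[OF hol op] deriv_transition_nonzero[OF X c W'(1)] im[OF ch]
      by (intro continuous_intros continuous_on_compose2[OF continuous_on_kodaira_spencer[OF h r(1)]]
          holomorphic_on_imp_continuous_on) auto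
    then have "(\<lambda>z. indicator (overlap c W) z *\<^sub>R (?ks (transition c W z) *
           cnj (deriv (transition c W) z) / deriv (transition c W) z)) \<in> borel_measurable borel"
      using op by (intro borel_measurable_continuous_on_indicator) auto
    also have "(\<lambda>z. indicator (overlap c W) z *\<^sub>R (?ks (transition c W z) *
           cnj (deriv (transition c W) z) / deriv (transition c W) z)) =
        (\<lambda>z. indicator (punctured_image P c) z *\<^sub>R twist_beltrami W h r1 r0 r2 c z)"
      using sub by (auto simp: twist_beltrami_def indicator_def fun_eq_iff)
    finally show ?thesis by (simp add: set_borel_measurable_def)
  qed
  ultimately show ?thesis
    using twist_beltrami_transform[OF X W'(1)] unfolding beltrami_differentials_def by blast
qed

text \<open>Being a Beltrami differential, \<open>\<mu>\<close> lies in its own class. The class is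
  then nonempty and pairs to a single value, which pins down the \<open>THE\<close>.\<close>

lemma tangent_pairing_tangent_vector:
  assumes "\<mu> \<in> beltrami_differentials X \<A> P" "\<phi> \<in> quadratic_differentials X \<A> P"
  shows "tangent_pairing X \<A> (tangent_vector X \<A> P \<mu>) \<phi> = beltrami_pairing X \<A> \<mu> \<phi>"
  unfolding tangent_pairing_def
proof (rule the_equality)
  have "\<mu> \<in> tangent_vector X \<A> P \<mu>" using assms by (simp add: tangent_vector_def)
  then show "tangent_vector X \<A> P \<mu> \<noteq> {} \<and>
    (\<forall>\<nu>\<in>tangent_vector X \<A> P \<mu>. beltrami_pairing X \<A> \<nu> \<phi> = beltrami_pairing X \<A> \<mu> \<phi>)"
    using assms(2) by (auto simp: tangent_vector_def)
  show "w = beltrami_pairing X \<A> \<mu> \<phi>" if "tangent_vector X \<A> P \<mu> \<noteq> {} \<and>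
    (\<forall>\<nu>\<in>tangent_vector X \<A> P \<mu>. beltrami_pairing X \<A> \<nu> \<phi> = w)" for w
    using that \<open>\<mu> \<in> tangent_vector X \<A> P \<mu>\<close> by metis
qed

section \<open>Polar coordinates on the annulus\<close>

lemma ln_less_iff_less_exp: "0 < a \<Longrightarrow> ln a < x \<longleftrightarrow> a < exp x" for a x :: real
  by (metis exp_less_cancel_iff exp_ln)

lemma less_ln_iff_exp_less: "0 < a \<Longrightarrow> x < ln a \<longleftrightarrow> exp x < a" for a x :: real
  by (metis exp_less_cancel_iff exp_ln)

text \<open>On a circle around 0, dz = i z dt, so up to the factor i the integral is the contour
  integral of z phi(z), which is holomorphic on the annulus. Concentric circles there are homotopic
  through radial segments.\<close>

lemma circle_integral_cong:
  assumes hol: "\<phi> holomorphic_on annulus r1 r2" and r: "0 < r1" "r1 < r" "r < r2" "r1 < s" "s < r2"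
  shows "integral {0..2 * pi} (\<lambda>t. (of_real r * cis t)\<^sup>2 * \<phi> (of_real r * cis t)) =
         integral {0..2 * pi} (\<lambda>t. (of_real s * cis t)\<^sup>2 * \<phi> (of_real s * cis t))"
proof -
  have eq: "contour_integral (circlepath 0 r) (\<lambda>z. z * \<phi> z) =
      \<i> * integral {0..2 * pi} (\<lambda>t. (of_real r * cis t)\<^sup>2 * \<phi> (of_real r * cis t))" for r
    unfolding circlepath_def
    by (subst contour_integral_part_circlepath_eq)
      (auto simp: power2_eq_square algebra_simps intro!: integral_cong simp flip: integral_mult_right)
  have "homotopic_loops (annulus r1 r2) (circlepath 0 r) (circlepath 0 s)"
  proof (rule homotopic_loops_linear)
    fix t :: real
    show "closed_segment (circlepath 0 r t) (circlepath 0 s t) \<subseteq> annulus r1 r2"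
    proof
      fix z assume "z \<in> closed_segment (circlepath 0 r t) (circlepath 0 s t)"
      then obtain u where u: "0 \<le> u" "u \<le> 1"
        "z = (1 - u) *\<^sub>R (of_real r * exp (2 * of_real pi * \<i> * of_real t)) + u *\<^sub>R (of_real s * exp (2 * of_real pi * \<i> * of_real t))"
        by (auto simp: closed_segment_def circlepath)
      then have "z = of_real ((1 - u) * r + u * s) * exp (2 * of_real pi * \<i> * of_real t)"
        by (simp add: scaleR_conv_of_real algebra_simps)
      then have "cmod z = \<bar>(1 - u) * r + u * s\<bar>"
        by (simp only: norm_mult norm_of_real) simp
      moreover have "(1 - u) * r + u * s \<in> closed_segment r s"
        using u by (auto simp: closed_segment_def)
      ultimately show "z \<in> annulus r1 r2"
        using r by (auto simp: closed_segment_eq_real_ivl split: if_splits)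
    qed
  qed auto
  then have "contour_integral (circlepath 0 r) (\<lambda>z. z * \<phi> z) = contour_integral (circlepath 0 s) (\<lambda>z. z * \<phi> z)"
    using hol open_annulus
    by (intro Cauchy_theorem_homotopic_loops[where S = "annulus r1 r2"] holomorphic_intros) auto
  then show ?thesis by (simp add: eq)
qed

text \<open>Polar coordinates with the logarithm of the radius as a variable: \<open>exp\<close>
  maps a strip of height 2 pi, half-open so as to be injective, onto the annulus, with Jacobian
  |e^w|^2 = e^(2x). Fubini then splits the strip.\<close>

lemma set_lebesgue_integral_annulus:
  fixes \<omega> :: "complex \<Rightarrow> complex"
  assumes r: "0 < r1" "r1 < r2" and int: "set_integrable lborel (annulus r1 r2) \<omega>"
  shows "(LINT z:annulus r1 r2|lborel. \<omega> z) =
    (LINT x:{ln r1<..<ln r2}|lborel. LINT y:{0..<2 * pi}|lborel. exp (2 * x) *\<^sub>R \<omega> (of_real (exp x) * cis y))"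
proof -
  define S where "S = {w. ln r1 < Re w \<and> Re w < ln r2 \<and> 0 \<le> Im w \<and> Im w < 2 * pi}"
  have S: "S \<in> sets borel"
    unfolding S_def by measurable
  have inj: "inj_on exp S"
    by (rule inj_onI) (auto simp: S_def intro!: exp_complex_eqI)
  have im: "exp ` S = annulus r1 r2"
  proof
    show "exp ` S \<subseteq> annulus r1 r2"
      using r by (auto simp: S_def ln_less_iff_less_exp less_ln_iff_exp_less)
    show "annulus r1 r2 \<subseteq> exp ` S"
    proof
      fix z assume z: "z \<in> annulus r1 r2"
      then have z0: "z \<noteq> 0" "0 < cmod z" using r by auto
      \<comment> \<open>The preimage of z is built with \<open>Arg2pi\<close>, whose range from 0
        inclusive to 2 pi exclusive is exactly the height of the strip.\<close>
      have "exp (Complex (ln (cmod z)) (Arg2pi z)) = of_real (cmod z) * exp (\<i> * of_real (Arg2pi z))"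
        using z0 by (simp add: exp_eq_polar[of "Complex _ _"] cis_conv_exp)
      also have "\<dots> = z" by (rule Arg2pi_eq[symmetric])
      finally have "exp (Complex (ln (cmod z)) (Arg2pi z)) = z" .
      moreover have "Complex (ln (cmod z)) (Arg2pi z) \<in> S"
        using z r z0 by (auto simp: S_def Arg2pi_ge_0 Arg2pi_lt_2pi)
      ultimately show "z \<in> exp ` S" by (metis image_eqI)
    qed
  qed
  have b: "exp ` S \<in> sets borel" unfolding im using open_annulus by simp
  note cv = holomorphic_change_of_variables[OF open_UNIV holomorphic_on_exp S subset_UNIV inj b, unfolded im, OF int]
  define D where "D = (\<lambda>w. indicator S w *\<^sub>R (cmod (deriv exp w))\<^sup>2 *\<^sub>R \<omega> (exp w))"
  have D: "integrable lborel D" using cv(1) by (simp only: set_integrable_def D_def)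
  have mC: "(\<lambda>(x, y). Complex x y) \<in> borel_measurable (lborel \<Otimes>\<^sub>M lborel)"
    unfolding lborel_prod measurable_lborel2
    by (intro borel_measurable_continuous_onI) (auto intro!: continuous_intros simp: complex_eq case_prod_unfold)
  have D2: "integrable (lborel \<Otimes>\<^sub>M lborel) (\<lambda>(x, y). D (Complex x y))"
    using integrable_distr[OF mC D[unfolded lborel_eq_distr_pair]] by (simp add: case_prod_unfold)
  have "(LINT z:annulus r1 r2|lborel. \<omega> z) = integral\<^sup>L lborel D"
    using cv(2) by (simp only: set_lebesgue_integral_def D_def)
  also have "\<dots> = integral\<^sup>L (lborel \<Otimes>\<^sub>M lborel) (\<lambda>(x, y). D (Complex x y))"
    using D by (subst lborel_eq_distr_pair, subst integral_distr[OF mC]) (auto simp: case_prod_unfold)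
  also have "\<dots> = (LINT x|lborel. LINT y|lborel. D (Complex x y))"
    using lborel_pair.integral_fst'[OF D2] by simp
  also have "\<dots> = (LINT x:{ln r1<..<ln r2}|lborel. LINT y:{0..<2 * pi}|lborel. exp (2 * x) *\<^sub>R \<omega> (of_real (exp x) * cis y))"
    unfolding set_lebesgue_integral_def
  proof (intro Bochner_Integration.integral_cong refl)
    fix x
    have "D (Complex x y) = indicator {ln r1<..<ln r2} x *\<^sub>R indicator {0..<2 * pi} y *\<^sub>R exp (2 * x) *\<^sub>R \<omega> (of_real (exp x) * cis y)" for y
      by (auto simp: D_def S_def indicator_def exp_eq_polar norm_mult exp_double DERIV_imp_deriv[OF DERIV_exp])
    then show "(LINT y|lborel. D (Complex x y)) = indicator {ln r1<..<ln r2} x *\<^sub>R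
       (LINT y|lborel. indicator {0..<2 * pi} y *\<^sub>R exp (2 * x) *\<^sub>R \<omega> (of_real (exp x) * cis y))"
      by (simp only: integral_scaleR_right)
  qed
  finally show ?thesis .
qed

text \<open>The integrand is the derivative of h(e^x), whose values at the two ends are 0 and 1. The
  fundamental theorem is applied on the closed interval from \<open>ln s1\<close> to
  \<open>ln s2\<close>; outside it the derivative of \<open>h\<close> vanishes.\<close>

lemma cutoff_integral:
  assumes h: "twist_cutoff r1 r2 h" and r: "0 < r1" "r1 < r2"
  shows "(LINT x:{ln r1<..<ln r2}|lborel. deriv h (exp x) * exp x) = 1"
proof -
  obtain s1 s2 where s: "r1 < s1" "s1 < s2" "s2 < r2" and h0: "\<And>r. r1 < r \<Longrightarrow> r \<le> s1 \<Longrightarrow> h r = 0"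
    and h1: "\<And>r. s2 \<le> r \<Longrightarrow> r < r2 \<Longrightarrow> h r = 1"
    and d0: "\<And>r. r1 < r \<Longrightarrow> r < r2 \<Longrightarrow> r \<notin> {s1..s2} \<Longrightarrow> deriv h r = 0"
    using twist_cutoff_ends[OF h r(2)] by metis
  have bnd: "r1 < exp x \<and> exp x < r2" if "ln s1 \<le> x" "x \<le> ln s2" for x
    using that s r by (auto simp: ln_less_iff_less_exp less_ln_iff_exp_less simp flip: not_less)
  have der: "((\<lambda>x. h (exp x)) has_real_derivative deriv h (exp x) * exp x) (at x)" if "ln s1 \<le> x" "x \<le> ln s2" for x
    using DERIV_chain2[OF twist_cutoff_deriv(1)[OF h] DERIV_exp] bnd[OF that] by blast
  have "has_bochner_integral lborel (\<lambda>x. indicator {ln s1..ln s2} x *\<^sub>R (deriv h (exp x) * exp x))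
      (h (exp (ln s2)) - h (exp (ln s1)))"
  proof (rule has_bochner_integral_FTC_Icc)
    show "ln s1 \<le> ln s2" using s r by simp
    show "((\<lambda>x. h (exp x)) has_vector_derivative deriv h (exp x) * exp x) (at x within {ln s1..ln s2})"
      if "ln s1 \<le> x" "x \<le> ln s2" for x
      using der[OF that] by (simp add: has_field_derivative_at_within has_real_derivative_iff_has_vector_derivative[symmetric])
    show "continuous_on {ln s1..ln s2} (\<lambda>x. deriv h (exp x) * exp x)"
    proof (intro continuous_intros continuous_at_imp_continuous_on ballI)
      fix x assume "x \<in> {ln s1..ln s2}"
      then have "isCont (deriv h) (exp x)" using bnd twist_cutoff_deriv(2)[OF h] by auto
      then show "isCont (\<lambda>x. deriv h (exp x)) x" by (rule isCont_o2[OF isCont_exp])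
    qed
  qed
  moreover have "h (exp (ln s2)) = 1" "h (exp (ln s1)) = 0"
    using s r by (auto intro!: h0 h1)
  ultimately have "(LINT x|lborel. indicator {ln s1..ln s2} x *\<^sub>R (deriv h (exp x) * exp x)) = 1"
    by (simp add: has_bochner_integral_integral_eq)
  moreover have "indicator {ln s1..ln s2} x *\<^sub>R (deriv h (exp x) * exp x) =
      indicator {ln r1<..<ln r2} x *\<^sub>R (deriv h (exp x) * exp x)" for x
  proof (cases "x \<in> {ln s1..ln s2}")
    case True
    then have "r1 < exp x" "exp x < r2" using bnd by auto
    then have "ln r1 < x" "x < ln r2" using r by (auto simp: ln_less_iff_less_exp less_ln_iff_exp_less)
    then show ?thesis using True by simp
  next
    case False
    have "deriv h (exp x) = 0" if "ln r1 < x" "x < ln r2"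
    proof (rule d0)
      show "r1 < exp x" "exp x < r2" using that r by (auto simp: ln_less_iff_less_exp less_ln_iff_exp_less)
      show "exp x \<notin> {s1..s2}"
        using False s r by (auto simp: ln_less_iff_less_exp less_ln_iff_exp_less not_le)
    qed
    then show ?thesis using False by (auto simp: indicator_def)
  qed
  ultimately show ?thesis by (simp only: set_lebesgue_integral_def)
qed

text \<open>\<open>\<phi>\<close> may be unbounded near the boundary of the annulus, but the kernel
  vanishes off a compact subannulus, where the product is continuous.\<close>

lemma set_integrable_kodaira_spencer:
  assumes h: "twist_cutoff r1 r2 h" and r: "0 < r1" "r1 < r2" and \<phi>: "continuous_on (annulus r1 r2) \<phi>"
  shows "set_integrable lborel (annulus r1 r2) (\<lambda>z. kodaira_spencer (twist_family h r1 r0 r2) z * \<phi> z)"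
proof -
  let ?ks = "kodaira_spencer (twist_family h r1 r0 r2)"
  obtain s1 s2 where s: "r1 < s1" "s1 < s2" "s2 < r2"
    and d0: "\<And>r. r1 < r \<Longrightarrow> r < r2 \<Longrightarrow> r \<notin> {s1..s2} \<Longrightarrow> deriv h r = 0"
    using twist_cutoff_ends[OF h r(2)] by metis
  define K where "K = cball 0 s2 - ball (0::complex) s1"
  have K: "compact K" "K \<subseteq> annulus r1 r2"
    using s by (auto simp: K_def intro: compact_diff)
  have "integrable lborel (\<lambda>z. indicator K z *\<^sub>R (?ks z * \<phi> z))"
    using K continuous_on_kodaira_spencer[OF h r(1)] \<phi>
    by (intro borel_integrable_compact continuous_intros) (auto intro: continuous_on_subset)
  also have "(\<lambda>z. indicator K z *\<^sub>R (?ks z * \<phi> z)) = (\<lambda>z. indicator (annulus r1 r2) z *\<^sub>R (?ks z * \<phi> z))"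
  proof
    fix z show "indicator K z *\<^sub>R (?ks z * \<phi> z) = indicator (annulus r1 r2) z *\<^sub>R (?ks z * \<phi> z)"
    proof (cases "z \<in> annulus r1 r2 - K")
      case True
      then have "?ks z = 0"
        using kodaira_spencer_twist_family[OF h r(1), of z r0] d0[of "cmod z"] by (auto simp: K_def)
      then show ?thesis by simp
    next
      case False
      then show ?thesis using K(2) by (auto simp: indicator_def)
    qed
  qed
  finally show ?thesis by (simp add: set_integrable_def)
qed

text \<open>The Jacobian e^(2x) against z^2/|z| with |z| = e^x leaves h'(e^x) e^x times z^2. The
  variables separate, since the angular integral is the same on every circle and can be evaluated at
  \<open>r0\<close>.\<close>

lemma annulus_integral_kodaira_spencer:
  assumes h: "twist_cutoff r1 r2 h" and r: "0 < r1" "r1 < r0" "r0 < r2" and \<phi>: "\<phi> holomorphic_on annulus r1 r2"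
  shows "(LINT z:annulus r1 r2|lborel. kodaira_spencer (twist_family h r1 r0 r2) z * \<phi> z) =
    - \<i> / (2 * of_real r0) * integral {0..2 * pi} (\<lambda>t. (of_real r0 * cis t)\<^sup>2 * \<phi> (of_real r0 * cis t))"
    (is "_ = _ * ?J")
proof -
  let ?ks = "kodaira_spencer (twist_family h r1 r0 r2)"
  have r12: "r1 < r2" using r by simp
  have inner: "(LINT y:{0..<2 * pi}|lborel. exp (2 * x) *\<^sub>R (?ks (of_real (exp x) * cis y) * \<phi> (of_real (exp x) * cis y)))
      = of_real (deriv h (exp x) * exp x) * (- \<i> / (2 * of_real r0) * ?J)" if x: "x \<in> {ln r1<..<ln r2}" for x
  proof -
    have ex: "r1 < exp x" "exp x < r2" using x r r12 by (auto simp: ln_less_iff_less_exp less_ln_iff_exp_less)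
    have an: "of_real (exp x) * cis y \<in> annulus r1 r2" for y
      using ex by (simp add: norm_mult)
    let ?f = "\<lambda>y. (of_real (exp x) * cis y)\<^sup>2 * \<phi> (of_real (exp x) * cis y)"
    have cont: "continuous_on {0..2 * pi} ?f"
      using an by (intro continuous_intros continuous_on_compose2[OF holomorphic_on_imp_continuous_on[OF \<phi>]]) auto
    have "(LINT y:{0..<2 * pi}|lborel. exp (2 * x) *\<^sub>R (?ks (of_real (exp x) * cis y) * \<phi> (of_real (exp x) * cis y))) =
      (LINT y:{0..<2 * pi}|lborel. of_real (deriv h (exp x) * exp x) * (- \<i> / (2 * of_real r0)) * ?f y)"
    proof (intro set_lebesgue_integral_cong ballI allI impI)
      fix y
      show "exp (2 * x) *\<^sub>R (?ks (of_real (exp x) * cis y) * \<phi> (of_real (exp x) * cis y)) =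
        of_real (deriv h (exp x) * exp x) * (- \<i> / (2 * of_real r0)) * ?f y"
        using kodaira_spencer_twist_family[OF h r(1) an[of y], of r0]
        by (simp add: norm_mult exp_double scaleR_conv_of_real power2_eq_square)
    qed simp
    also have "\<dots> = of_real (deriv h (exp x) * exp x) * (- \<i> / (2 * of_real r0)) * (LINT y:{0..<2 * pi}|lborel. ?f y)"
      by (rule set_integral_mult_right)
    \<comment> \<open>The half-open interval of the strip is closed up by a single point, a null
      set.\<close>
    also have "(LINT y:{0..<2 * pi}|lborel. ?f y) = (LINT y:{0..2 * pi}|lborel. ?f y)"
      by (rule set_integral_discrete_difference[of "{2 * pi}"]) auto
    also have "\<dots> = integral {0..2 * pi} ?f"
      by (intro set_borel_integral_eq_integral borel_integrable_atLeastAtMost' cont)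
    also have "\<dots> = ?J"
      using circle_integral_cong[OF \<phi> r(1) ex r(2,3)] by simp
    finally show ?thesis by simp
  qed
  have "(LINT z:annulus r1 r2|lborel. ?ks z * \<phi> z) =
    (LINT x:{ln r1<..<ln r2}|lborel. LINT y:{0..<2 * pi}|lborel.
        exp (2 * x) *\<^sub>R (?ks (of_real (exp x) * cis y) * \<phi> (of_real (exp x) * cis y)))"
    by (intro set_lebesgue_integral_annulus r12 r(1) set_integrable_kodaira_spencer h holomorphic_on_imp_continuous_on \<phi>)
  also have "\<dots> = (LINT x:{ln r1<..<ln r2}|lborel. of_real (deriv h (exp x) * exp x) * (- \<i> / (2 * of_real r0) * ?J))"
    using inner by (intro set_lebesgue_integral_cong) auto
  also have "\<dots> = (LINT x:{ln r1<..<ln r2}|lborel. of_real (deriv h (exp x) * exp x)) * (- \<i> / (2 * of_real r0) * ?J)"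
    by (rule set_integral_mult_left)
  also have "(LINT x:{ln r1<..<ln r2}|lborel. of_real (deriv h (exp x) * exp x)) = (1 :: complex)"
    unfolding set_integral_complex_of_real cutoff_integral[OF h r(1) r12] by simp
  finally show ?thesis by simp
qed

text \<open>In the product with a quadratic differential the two coordinate factors combine to (cnj
  d / d) d^2 = |d|^2, the law of a (1,1)-form. The annulus avoids the punctures, so the poles of
  \<open>\<phi>\<close> stay outside the support.\<close>

lemma beltrami_pairing_twist:
  assumes X: "compact_riemann_surface X \<A>" and W: "twist_annulus X \<A> P u L r1 r0 r2 W"
    and h: "twist_cutoff r1 r2 h" and \<phi>: "\<phi> \<in> quadratic_differentials X \<A> P"
  shows "beltrami_pairing X \<A> (twist_beltrami W h r1 r0 r2) \<phi> =
    - \<i> / (2 * of_real r0) * integral {0..2 * pi} (\<lambda>t. (of_real r0 * cis t)\<^sup>2 * \<phi> W (of_real r0 * cis t))"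
proof -
  let ?ks = "kodaira_spencer (twist_family h r1 r0 r2)" and ?\<mu> = "twist_beltrami W h r1 r0 r2"
  have W': "W \<in> hol_charts X \<A>" "fst W \<inter> P = {}" "coord_image W = annulus r1 r2" 
    and r: "0 < r1" "r1 < r0" "r0 < r2"
    using W by (auto simp: twist_annulus_def)
  note chW = hol_charts_is_chart[OF W'(1)]
  have sub: "overlap c W \<subseteq> punctured_image P c" for c
    using W'(2) by (auto simp: overlap_def punctured_image_def)
  have ov: "overlap W W = annulus r1 r2"
    using W'(3) by (simp add: overlap_def coord_image_def)
  have pW: "punctured_image P W = annulus r1 r2"
    using W'(2,3) by (auto simp: punctured_image_def coord_image_def Diff_triv)
  have hol: "\<phi> W holomorphic_on annulus r1 r2"
    using \<phi> W'(1) pW by (auto simp: quadratic_differentials_def)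
  have tW: "transition W W z = z" if z: "z \<in> annulus r1 r2" for z
  proof -
    obtain q where "q \<in> fst W" "z = snd W q"
      using z unfolding W'(3)[symmetric] coord_image_def by blast
    then show ?thesis by (simp add: transition_apply[OF chW])
  qed
  have \<mu>W: "?\<mu> W z = ?ks z" if "z \<in> annulus r1 r2" for z
    using that deriv_transition_self[OF chW] W'(3) by (simp add: twist_beltrami_def ov tW)
  have int: "set_integrable lborel (coord_image W) (\<lambda>z. ?\<mu> W z * \<phi> W z)"
  proof -
    have "set_integrable lborel (annulus r1 r2) (\<lambda>z. ?ks z * \<phi> W z)"
      using h r hol by (intro set_integrable_kodaira_spencer holomorphic_on_imp_continuous_on) auto
    then show ?thesis
      unfolding W'(3) by (rule set_integrable_cong[THEN iffD1, rotated -1]) (auto simp: \<mu>W)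
  qed
  have "beltrami_pairing X \<A> ?\<mu> \<phi> = (LINT z:coord_image W|lborel. ?\<mu> W z * \<phi> W z)"
    unfolding beltrami_pairing_def
  proof (rule surface_integral_supported_in_chart[where \<omega> = "\<lambda>c z. ?\<mu> c z * \<phi> c z", OF X W'(1) _ _ int])
    fix c z assume c: "c \<in> hol_charts X \<A>"
    show "?\<mu> c z * \<phi> c z = 0" if "z \<notin> overlap c W"
      using that by (simp add: twist_beltrami_def)
    assume z: "z \<in> overlap c W"
    let ?d = "deriv (transition c W) z"
    have "\<phi> c z = \<phi> W (transition c W z) * ?d\<^sup>2"
      using \<phi> c W'(1) z sub[of c] unfolding quadratic_differentials_def by blast
    moreover have "?\<mu> c z = ?\<mu> W (transition c W z) * cnj ?d / ?d"
      by (rule twist_beltrami_transform[OF X W'(1) c W'(1) z])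
    ultimately show "?\<mu> c z * \<phi> c z = (cmod ?d)\<^sup>2 *\<^sub>R (?\<mu> W (transition c W z) * \<phi> W (transition c W z))"
      using complex_norm_square[of ?d]
      by (simp add: scaleR_conv_of_real power2_eq_square[of ?d] mult_ac)
  qed
  also have "\<dots> = (LINT z:annulus r1 r2|lborel. ?ks z * \<phi> W z)"
    unfolding W'(3) using open_annulus by (intro set_lebesgue_integral_cong) (auto simp: \<mu>W)
  finally show ?thesis
    using annulus_integral_kodaira_spencer[OF h r hol] by simp
qed

text \<open>The chart in the integrand is chosen by \<open>SOME\<close>. Moving to \<open>W\<close>
  multiplies the differential and the squared velocity by the squares of two mutually inverse
  derivatives, so every choice gives the integrand read in \<open>W\<close>.\<close>

lemma geodesic_integral_twist_annulus:
  assumes X: "compact_riemann_surface X \<A>" and W: "twist_annulus X \<A> P u L r1 r0 r2 W"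
    and \<phi>: "\<phi> \<in> quadratic_differentials X \<A> P"
  shows "geodesic_integral X \<A> \<phi> u L =
    - 1 / of_real r0 * integral {0..2 * pi} (\<lambda>t. (of_real r0 * cis t)\<^sup>2 * \<phi> W (of_real r0 * cis t))"
proof -
  have W': "W \<in> hol_charts X \<A>" "fst W \<inter> P = {}" and r: "0 < r0" and L: "L = 2 * pi * r0"
    and u: "\<And>t. u t \<in> fst W" "\<And>t. snd W (u t) = of_real r0 * exp (\<i> * of_real (t / r0))"
    using W unfolding twist_annulus_def by auto
  note chW = hol_charts_is_chart[OF W'(1)]
  have integrand: "(let c = SOME c. c \<in> hol_charts X \<A> \<and> u t \<in> fst c
     in \<phi> c (snd c (u t)) * (vector_derivative (\<lambda>s. snd c (u s)) (at t))\<^sup>2) =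
     (- 1 / (of_real r0)\<^sup>2) * ((of_real r0 * cis (1 / r0 * t))\<^sup>2 * \<phi> W (of_real r0 * cis (1 / r0 * t)))" for t
  proof -
    define c where "c = (SOME c. c \<in> hol_charts X \<A> \<and> u t \<in> fst c)"
    have "c \<in> hol_charts X \<A> \<and> u t \<in> fst c"
      unfolding c_def by (rule someI[of _ W]) (use W' u in auto)
    then have c: "c \<in> hol_charts X \<A>" and ut: "u t \<in> fst c" by auto
    note ch = hol_charts_is_chart[OF c]
    let ?v = "\<lambda>s. of_real r0 * exp (\<i> * of_real (s / r0))"
    have "snd W (u t) \<in> overlap W c" and zc: "snd c (u t) \<in> overlap c W"
      using ut u(1) by (auto simp: overlap_def)
    then have z: "?v t \<in> overlap W c" by (simp only: u(2))
    have dv: "(?v has_vector_derivative \<i> * exp (\<i> * of_real (t / r0))) (at t)"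
    proof -
      have "((\<lambda>s. of_real r0 * exp (\<i> * (s / of_real r0))) has_field_derivative
          \<i> * exp (\<i> * (of_real t / of_real r0))) (at (of_real t))"
        using r by (auto intro!: derivative_eq_intros)
      from has_vector_derivative_real_field[OF this] show ?thesis by simp
    qed
    let ?D = "deriv (transition W c) (?v t)" and ?D' = "deriv (transition c W) (snd c (u t))"
    have "(transition W c has_field_derivative ?D) (at (?v t))"
      using transition_holomorphic[OF X W'(1) c] open_overlap[OF chW ch] z by (rule holomorphic_derivI)
    then have "((transition W c \<circ> ?v) has_vector_derivative \<i> * exp (\<i> * of_real (t / r0)) * ?D) (at t)"
      using field_vector_diff_chain_at[OF dv] by simp
    moreover have "transition W c \<circ> ?v = (\<lambda>s. snd c (u s))"
      unfolding u(2)[symmetric] by (rule ext) (simp add: transition_apply[OF chW u(1)])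
    ultimately have vd: "vector_derivative (\<lambda>s. snd c (u s)) (at t) = \<i> * exp (\<i> * of_real (t / r0)) * ?D"
      by (simp add: vector_derivative_at)
    have tr: "transition c W (snd c (u t)) = ?v t"
      using transition_apply[OF ch ut] u(2) by simp
    have \<phi>c: "\<phi> c (snd c (u t)) = \<phi> W (?v t) * ?D'\<^sup>2"
    proof -
      have "snd c (u t) \<in> punctured_image P c"
        using ut u(1)[of t] W'(2) by (auto simp: punctured_image_def)
      then show ?thesis
        using \<phi> c W'(1) zc tr unfolding quadratic_differentials_def by fastforce
    qed
    have DD: "?D * ?D' = 1"
    proof -
      have "snd c (u t) \<in> overlap c c" "snd c (u t) \<in> coord_image c"
        using ut by (auto simp: overlap_def coord_image_def)
      then show ?thesis
        using deriv_transition_compose[OF X c W'(1) c zc] deriv_transition_self[OF ch] tr by simp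
    qed
    have "\<phi> c (snd c (u t)) * (vector_derivative (\<lambda>s. snd c (u s)) (at t))\<^sup>2 =
       \<phi> W (?v t) * (\<i> * exp (\<i> * of_real (t / r0)))\<^sup>2 * (?D * ?D')\<^sup>2"
      unfolding vd \<phi>c by (simp only: power_mult_distrib mult_ac)
    \<comment> \<open>The velocity is i e^(it/r0), that is i/r0 times the point itself; squaring
      produces the factor -1/r0^2.\<close>
    also have "\<dots> = (- 1 / (of_real r0)\<^sup>2) * ((?v t)\<^sup>2 * \<phi> W (?v t))"
      using r unfolding DD by (simp add: power_mult_distrib field_simps)
    finally show ?thesis
      by (simp add: c_def Let_def cis_conv_exp)
  qed
  let ?f = "\<lambda>t. (of_real r0 * cis t)\<^sup>2 * \<phi> W (of_real r0 * cis t)"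
  have im: "(\<lambda>x. x / (1 / r0)) ` {0..2 * pi} = {0..2 * pi * r0}"
    using image_mult_atLeastAtMost[OF r, of 0 "2 * pi"] by (simp add: mult.commute)
  have "geodesic_integral X \<A> \<phi> u L = integral {0..2 * pi * r0} (\<lambda>t. (- 1 / (of_real r0)\<^sup>2) * ?f (1 / r0 * t))"
    unfolding geodesic_integral_def integrand L ..
  also have "\<dots> = (- 1 / (of_real r0)\<^sup>2) * integral {0..2 * pi * r0} (\<lambda>t. ?f (1 / r0 * t))"
    by (rule integral_mult_right)
  \<comment> \<open>Arc length is t = r0 theta, and this substitution returns one factor r0.\<close>
  also have "integral {0..2 * pi * r0} (\<lambda>t. ?f (1 / r0 * t)) = of_real r0 * integral {0..2 * pi} ?f"
    using integral_stretch_real[of "1 / r0" 0 "2 * pi" ?f] r unfolding im by (simp add: scaleR_conv_of_real)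
  finally show ?thesis
    using r by (simp add: power2_eq_square)
qed

theorem theorem1p2:
  fixes X :: "'a topology" and \<A> :: "'a chart set"
    and p n N i :: nat
    and pt :: "nat \<Rightarrow> 'a" and a :: "nat \<Rightarrow> real"
    and g :: "'a chart \<Rightarrow> complex \<Rightarrow> real"
    and \<gamma> :: "nat \<Rightarrow> real \<Rightarrow> 'a" and L :: "nat \<Rightarrow> real"
    and W :: "'a chart" and h :: "real \<Rightarrow> real" and r1 r0 r2 :: real
    and \<phi> :: "'a chart \<Rightarrow> complex \<Rightarrow> complex"
  assumes "weighted_punctured_surface X \<A> p n pt a"
    and "\<forall>j\<in>{1..n}. a j \<in> {1/2..1}"
    and "hyperbolic_conical_metric X \<A> n pt a g"
    and "geodesic_pants_decomposition X \<A> (pt ` {1..n}) g N \<gamma> L"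
    and "i \<in> {1..N}"
    and "twist_annulus X \<A> (pt ` {1..n}) (\<gamma> i) (L i) r1 r0 r2 W"
    and "twist_cutoff r1 r2 h"
    and "\<phi> \<in> quadratic_differentials X \<A> (pt ` {1..n})"
  shows "tangent_pairing X \<A> (twist_vector X \<A> (pt ` {1..n}) W h r1 r0 r2) \<phi>
           = \<i> / 2 * geodesic_integral X \<A> \<phi> (\<gamma> i) (L i)"
proof -
  have X: "compact_riemann_surface X \<A>"
    using assms(1) by (simp add: weighted_punctured_surface_def)
  have "tangent_pairing X \<A> (twist_vector X \<A> (pt ` {1..n}) W h r1 r0 r2) \<phi> =
      beltrami_pairing X \<A> (twist_beltrami W h r1 r0 r2) \<phi>"
    unfolding twist_vector_def
    by (intro tangent_pairing_tangent_vector twist_beltrami_in_beltrami_differentials[OF X assms(6,7)] assms(8))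
  \<comment> \<open>Both sides are now multiples of the same circle integral, with -i/(2 r0) =
    (i/2)(-1/r0).\<close>
  also have "\<dots> = \<i> / 2 * geodesic_integral X \<A> \<phi> (\<gamma> i) (L i)"
    unfolding beltrami_pairing_twist[OF X assms(6,7,8)] geodesic_integral_twist_annulus[OF X assms(6,8)]
    by simp
  finally show ?thesis .
qed

end
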